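(* Assume $\Omega$ is such that the Friedrichs inequality $\|w\| \le C_F\|\nabla w\|$ holds for all $w\in H^1_0$ with a constant $C_F>0$. Let $c\in L^\infty(\Omega)$ be real with $c\ge 0$ a.e., let $\Omega_0 := \{x\in\Omega : c(x)=0\}$ and $\Omega_c := \Omega\setminus\Omega_0$, and assume $c\ge c_0>0$ a.e. in $\Omega_c$ for a constant $c_0$, and $c-\operatorname{div} b\ge 0$ a.e. in $\Omega$. Set $\hat c := c + \chi_{\Omega_0}$. Let $(u,p)\in H^1_0\times D$ be the exact solution of problem (P1) and let $(\tilde u,\tilde p)\in H^1_0\times D$ be arbitrary. Define $$E^2 := \|u-\tilde u\|_{c-\operatorname{div} b}^2 + \|\nabla(u-\tilde u)\|_A^2 + \|p-\tilde p\|_{A^{-1}}^2 + \|b\cdot\nabla(u-\tilde u) - \operatorname{div}(p-\tilde p)\|_{\hat c^{-1}}^2,$$ $$\mathcal M_3^+ := 2\Big(\|f - c\tilde u - b\cdot\nabla\tilde u + \operatorname{div}\tilde p\|_{\Omega_c,c^{-1}}^2 + \|\tilde p - A\nabla\tilde u\|_{A^{-1}}^2\Big) + \Big(1 + \tfrac{4C_F^2}{\alpha}\Big)\|f - b\cdot\nabla\tilde u + \operatorname{div}\tilde p\|_{\Omega_0}^2,$$ $$\mathcal M_3^- := \tfrac12\Big(\|f - c\tilde u - b\cdot\nabla\tilde u + \operatorname{div}\tilde p\|_{\Omega_c,c^{-1}}^2 + \|\tilde p - A\nabla\tilde u\|_{A^{-1}}^2\Big) + \|f - b\cdot\nabla\tilde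 u + \operatorname{div}\tilde p\|_{\Omega_0}^2 .$$ Then $$\|f - b\cdot\nabla\tilde u + \operatorname{div}\tilde p\|_{\Omega_0}^2 + \tfrac12\|\tilde p - A\nabla\tilde u\|_{A^{-1}}^2 \le E^2 \le \mathcal M_3^+ .$$ If in addition $-\operatorname{div} b\ge 0$ a.e. in $\Omega_c$, then $\mathcal M_3^-\le E^2$.
   Context: $\Omega \subset \mathbb R^d$ ($d\ge1$) is an open domain. All function spaces are over $\mathbb C$. $L^2 = L^2(\Omega)$ (scalar or vector valued) has inner product $(x,y) = \int_\Omega x\cdot\bar y$ and norm $\|\cdot\|$; for a measurable $\omega\subset\Omega$, $\|\cdot\|_\omega$ denotes the $L^2(\omega)$ norm. For a real scalar or Hermitian-matrix valued weight $\gamma \ge 0$ in $L^\infty$, $\|v\|_\gamma^2 := (\gamma v, v)$ and $\|v\|_{\omega,\gamma}^2 := \int_\omega \gamma v\cdot\bar v$. $\chi_{\Omega_0}$ is the characteristic function of $\Omega_0$. $H^1 = \{\varphi\in L^2 : \nabla\varphi\in L^2\}$, $D = \{\psi \in L^2(\Omega;\mathbb C^d) : \operatorname{div}\psi \in L^2\}$, and $H^1_0$ is the closure of $C_c^\infty(\Omega)$ in $H^1$. Coefficients: $A \in L^\infty(\Omega;\mathbb C^{d\times d})$ is pointwise Hermitian and satisfies $\alpha\|\varphi\|^2 \le (A\varphi,\varphi) \le \beta\|\varphi\|^2$ for all $\varphi\in L^2(\Omega;\mathbb C^d)$ with constants $0<\alpha\le\beta$; $b\in L^\infty(\Omega;\mathbb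 R^d)$ is real with distributional divergence $\operatorname{div} b \in L^\infty(\Omega)$; $f\in L^2$. Problem (P1): find $(u,p)\in H^1_0\times D$ with $p = A\nabla u$ and $-\operatorname{div} p + b\cdot\nabla u + c\,u = f$ a.e. in $\Omega$. *)

theory Defs
  imports "HOL-Analysis.Analysis"
begin

coinductive smooth_fn :: "('a::euclidean_space \<Rightarrow> 'b::real_normed_vector) \<Rightarrow> bool" where
  "(\<forall>x. f differentiable (at x)) \<Longrightarrow>
   (\<forall>v. smooth_fn (\<lambda>x. frechet_derivative f (at x) v)) \<Longrightarrow> smooth_fn f"

definition test_fn :: "(real^'n) set \<Rightarrow> (real^'n \<Rightarrow> complex) \<Rightarrow> bool" where
  "test_fn \<Omega> \<phi> \<longleftrightarrow> smooth_fn \<phi> \<and> compact (closure {x. \<phi> x \<noteq> 0})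
      \<and> closure {x. \<phi> x \<noteq> 0} \<subseteq> \<Omega>"

definition pd :: "'n::finite \<Rightarrow> (real^'n \<Rightarrow> complex) \<Rightarrow> real^'n \<Rightarrow> complex" where
  "pd i \<phi> x = frechet_derivative \<phi> (at x) (axis i 1)"

definition cgrad :: "(real^'n::finite \<Rightarrow> complex) \<Rightarrow> real^'n \<Rightarrow> complex^'n" where
  "cgrad \<phi> x = (\<chi> i. pd i \<phi> x)"

definition cdot :: "complex^'n::finite \<Rightarrow> complex^'n \<Rightarrow> complex" where
  "cdot v w = (\<Sum>i\<in>UNIV. v $ i * cnj (w $ i))"

definition L2 :: "(real^'n::finite) set \<Rightarrow> (real^'n \<Rightarrow> 'b::real_normed_vector) \<Rightarrow> bool" where
  "L2 \<Omega> f \<longleftrightarrow> f \<in> borel_measurable (lebesgue_on \<Omega>)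
      \<and> integrable (lebesgue_on \<Omega>) (\<lambda>x. (norm (f x))\<^sup>2)"

definition l2norm :: "(real^'n::finite) set \<Rightarrow> (real^'n \<Rightarrow> 'b::real_normed_vector) \<Rightarrow> real" where
  "l2norm \<Omega> f = sqrt (\<integral>x. (norm (f x))\<^sup>2 \<partial>lebesgue_on \<Omega>)"

definition Linf :: "(real^'n::finite) set \<Rightarrow> (real^'n \<Rightarrow> 'b::real_normed_vector) \<Rightarrow> bool" where
  "Linf \<Omega> f \<longleftrightarrow> f \<in> borel_measurable (lebesgue_on \<Omega>)
      \<and> (\<exists>M. AE x in lebesgue_on \<Omega>. norm (f x) \<le> M)"

definition weak_grad :: "(real^'n::finite) set \<Rightarrow> (real^'n \<Rightarrow> complex) \<Rightarrow> (real^'n \<Rightarrow> complex^'n) \<Rightarrow> bool" where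
  "weak_grad \<Omega> u g \<longleftrightarrow> (\<forall>\<phi>. test_fn \<Omega> \<phi> \<longrightarrow> (\<forall>i.
      (\<integral>x. u x * pd i \<phi> x \<partial>lebesgue_on \<Omega>) = - (\<integral>x. g x $ i * \<phi> x \<partial>lebesgue_on \<Omega>)))"

definition weak_div :: "(real^'n::finite) set \<Rightarrow> (real^'n \<Rightarrow> complex^'n) \<Rightarrow> (real^'n \<Rightarrow> complex) \<Rightarrow> bool" where
  "weak_div \<Omega> p q \<longleftrightarrow> (\<forall>\<phi>. test_fn \<Omega> \<phi> \<longrightarrow>
      (\<integral>x. (\<Sum>i\<in>UNIV. p x $ i * pd i \<phi> x) \<partial>lebesgue_on \<Omega>) = - (\<integral>x. q x * \<phi> x \<partial>lebesgue_on \<Omega>))"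

definition H10 :: "(real^'n::finite) set \<Rightarrow> (real^'n \<Rightarrow> complex) \<Rightarrow> bool" where
  "H10 \<Omega> u \<longleftrightarrow> L2 \<Omega> u \<and> (\<exists>g. L2 \<Omega> g \<and> weak_grad \<Omega> u g \<and>
      (\<exists>\<phi>. (\<forall>k. test_fn \<Omega> (\<phi> k)) \<and>
        (\<lambda>k. l2norm \<Omega> (\<lambda>x. \<phi> k x - u x) + l2norm \<Omega> (\<lambda>x. cgrad (\<phi> k) x - g x))
          \<longlonglongrightarrow> 0))"

definition Hdiv :: "(real^'n::finite) set \<Rightarrow> (real^'n \<Rightarrow> complex^'n) \<Rightarrow> bool" where
  "Hdiv \<Omega> p \<longleftrightarrow> L2 \<Omega> p \<and> (\<exists>q. L2 \<Omega> q \<and> weak_div \<Omega> p q)"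

definition cvec :: "real^'n::finite \<Rightarrow> complex^'n" where
  "cvec v = (\<chi> i. complex_of_real (v $ i))"

definition bdot :: "real^'n::finite \<Rightarrow> complex^'n \<Rightarrow> complex" where
  "bdot b g = (\<Sum>i\<in>UNIV. complex_of_real (b $ i) * g $ i)"

text \<open>Weighted squared norms.  Scalar real weight gamma: int gamma |v|^2 over Omega.
  Hermitian matrix weight G: int (G v) . conj v over Omega (real part; it is real).\<close>
definition wnorm2 :: "(real^'n::finite) set \<Rightarrow> (real^'n \<Rightarrow> real) \<Rightarrow> (real^'n \<Rightarrow> complex) \<Rightarrow> real" where
  "wnorm2 \<Omega> \<gamma> v = (\<integral>x. \<gamma> x * (cmod (v x))\<^sup>2 \<partial>lebesgue_on \<Omega>)"

definition mnorm2 :: "(real^'n::finite) set \<Rightarrow> (real^'n \<Rightarrow> complex^'n^'n) \<Rightarrow> (real^'n \<Rightarrow> complex^'n) \<Rightarrow> real" where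
  "mnorm2 \<Omega> G v = (\<integral>x. Re (cdot (G x *v v x) (v x)) \<partial>lebesgue_on \<Omega>)"

end

(*
  With e = u - ut, g = grad e, q = p - pt and r = b . g - div q, the residuals in the majorant are
  c e + r and A g - q. Expanding their weighted squares produces the terms of E^2 together with
  cross terms. Green's formula (g, q) = -(e, div q) and 2 Re (b . g, e) = -(div b e, e), both valid
  on H10 by density, cancel these up to 2 Re (e, r) on the set c = 0:
    E^2 = S1 + S2 + S3 + 2 Re (e, r)_{c = 0},   S3 = ||r||^2_{c = 0}.
  Young's inequality with Friedrichs' inequality and ellipticity absorbs the last term into
  E^2 - S3, giving the upper bound. The lower bounds hold pointwise by Young's inequality.
  The complex pairings enter only through their real parts, that is, through the real inner
  product of complex^'n.
*)
theory Submission
  imports Defs "HOL-Computational_Algebra.Polynomial"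
begin

section \<open>Smooth functions\<close>

text \<open>Two obstacles shape the development. First, the expansions are pointwise and contain
  A^{-1}, while ellipticity is assumed only under the integral. It has to be localized to almost
  every x, with an exceptional null set independent of the vector; this yields invertibility a.e.
  and the integrability of the terms weighted by A^{-1}. Second, \<open>H10\<close> asserts only
  that some weak gradient is approximated by gradients of test functions, whereas the theorem speaks
  about given gradients \<open>gu\<close> and \<open>gut\<close>. A.e. uniqueness of weak gradients
  closes this gap. It rests on the fundamental lemma of the calculus of variations, hence on a
  supply of explicit test functions, whose smoothness must be proved for the coinductive
  \<open>smooth_fn\<close>. Two integral identities are enough to treat all cross terms because
  these carry no coefficient: the flux residual is measured in A^{-1} and contributes g . q without
  A, and the reaction residual is measured in 1/c and contributes e . r without c. Where c = 0 the
  reaction residual is not part of S1, so its cross term has no partner there; this is the origin of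
  the term that Friedrichs' inequality must control.\<close>

lemma smooth_fn_differentiable: "smooth_fn f \<Longrightarrow> f differentiable (at x)"
  by (erule smooth_fn.cases) auto

lemma smooth_fn_derivative: "smooth_fn f \<Longrightarrow> smooth_fn (\<lambda>x. frechet_derivative f (at x) v)"
  by (erule smooth_fn.cases) auto

text \<open>\<open>smooth_fn\<close> is the largest class of differentiable functions closed under
  directional derivatives, so smoothness is proved by exhibiting one such class that contains the
  function. The later proofs differ only in the choice of \<open>X\<close>.\<close>

lemma smooth_fn_closedI:
  assumes "X f"
    and "\<And>f x. X f \<Longrightarrow> f differentiable (at x)"
    and "\<And>f v. X f \<Longrightarrow> X (\<lambda>x. frechet_derivative f (at x) v)"
  shows "smooth_fn f"
  using assms(1)
proof (coinduction arbitrary: f)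
  case smooth_fn
  then show ?case using assms(2,3) by blast
qed

lemma smooth_fn_bounded_linear:
  fixes L :: "'b::real_normed_vector \<Rightarrow> 'c::real_normed_vector"
  assumes L: "bounded_linear L" and f: "smooth_fn f"
  shows "smooth_fn (\<lambda>x. L (f x))"
proof (rule smooth_fn_closedI[where X = "\<lambda>h. \<exists>f. smooth_fn f \<and> h = (\<lambda>x. L (f x))"])
  have D: "((\<lambda>x. L (f x)) has_derivative (\<lambda>v. L (frechet_derivative f (at x) v))) (at x)"
    if "smooth_fn f" for f :: "'a \<Rightarrow> 'b" and x
    using smooth_fn_differentiable[OF that]
    by (intro bounded_linear.has_derivative[OF L]) (simp add: frechet_derivative_works)
  show "h differentiable at x" if "\<exists>f. smooth_fn f \<and> h = (\<lambda>x. L (f x))" for h :: "'a \<Rightarrow> 'c" and x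
    using that D unfolding differentiable_def by blast
  show "\<exists>f. smooth_fn f \<and> (\<lambda>x. frechet_derivative h (at x) v) = (\<lambda>x. L (f x))"
    if h: "\<exists>f. smooth_fn f \<and> h = (\<lambda>x. L (f x))" for h :: "'a \<Rightarrow> 'c" and v
  proof -
    obtain f where f: "smooth_fn f" "h = (\<lambda>x. L (f x))" using h by blast
    have "frechet_derivative h (at x) v = L (frechet_derivative f (at x) v)" for x
      using frechet_derivative_at[OF D[OF f(1)]] f(2) by metis
    then show ?thesis using smooth_fn_derivative[OF f(1)] by (intro exI[of _ "\<lambda>x. frechet_derivative f (at x) v"]) auto
  qed
qed (use f in blast)

lemma smooth_fn_diff:
  fixes f g :: "'a::euclidean_space \<Rightarrow> 'b::real_normed_vector"
  assumes "smooth_fn f" "smooth_fn g"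
  shows "smooth_fn (\<lambda>x. f x - g x)"
proof (rule smooth_fn_closedI[where X = "\<lambda>h. \<exists>f g. smooth_fn f \<and> smooth_fn g \<and> h = (\<lambda>x. f x - g x)"])
  have D: "((\<lambda>x. f x - g x) has_derivative
      (\<lambda>v. frechet_derivative f (at x) v - frechet_derivative g (at x) v)) (at x)"
    if "smooth_fn f" "smooth_fn g" for f g :: "'a \<Rightarrow> 'b" and x
    using that[THEN smooth_fn_differentiable] by (intro has_derivative_diff) (simp_all add: frechet_derivative_works)
  fix h :: "'a \<Rightarrow> 'b" assume "\<exists>f g. smooth_fn f \<and> smooth_fn g \<and> h = (\<lambda>x. f x - g x)"
  then obtain f g where fg: "smooth_fn f" "smooth_fn g" "h = (\<lambda>x. f x - g x)" by blast
  show "h differentiable at x" for x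
    using D[OF fg(1,2)] unfolding differentiable_def fg(3) by blast
  have "frechet_derivative h (at x) v = frechet_derivative f (at x) v - frechet_derivative g (at x) v" for x v
    unfolding fg(3) frechet_derivative_at[OF D[OF fg(1,2)], symmetric] ..
  then show "\<exists>f g. smooth_fn f \<and> smooth_fn g \<and> (\<lambda>x. frechet_derivative h (at x) v) = (\<lambda>x. f x - g x)" for v
    using smooth_fn_derivative[OF fg(1), of v] smooth_fn_derivative[OF fg(2), of v]
    by (intro exI[of _ "\<lambda>x. frechet_derivative f (at x) v"] exI[of _ "\<lambda>x. frechet_derivative g (at x) v"]) simp
qed (use assms in blast)

text \<open>By the Leibniz rule, sums of products of smooth functions are closed under derivatives;
  this is the coinduction invariant for products.\<close>
inductive prod_span :: "('a::euclidean_space \<Rightarrow> 'b::real_normed_algebra) \<Rightarrow> bool" where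
  prod: "smooth_fn f \<Longrightarrow> smooth_fn g \<Longrightarrow> prod_span (\<lambda>x. f x * g x)"
| sum: "prod_span f \<Longrightarrow> prod_span g \<Longrightarrow> prod_span (\<lambda>x. f x + g x)"

lemma smooth_fn_mult:
  fixes f g :: "'a::euclidean_space \<Rightarrow> 'b::real_normed_algebra"
  assumes "smooth_fn f" "smooth_fn g"
  shows "smooth_fn (\<lambda>x. f x * g x)"
proof (rule smooth_fn_closedI[where X = prod_span])
  \<comment> \<open>Both closure conditions go through one induction: in the sum case, the formula
    for the derivative needs the summands to be differentiable.\<close>
  have *: "(\<forall>x. h differentiable (at x)) \<and> (\<forall>v. prod_span (\<lambda>x. frechet_derivative h (at x) v))"
    if "prod_span h" for h :: "'a \<Rightarrow> 'b"
    using that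
  proof induction
    case (prod f g)
    let ?D = "\<lambda>x v. f x * frechet_derivative g (at x) v + frechet_derivative f (at x) v * g x"
    have D: "((\<lambda>x. f x * g x) has_derivative ?D x) (at x)" for x
      using prod smooth_fn_differentiable by (intro has_derivative_mult) (auto simp: frechet_derivative_works[symmetric])
    have "prod_span (\<lambda>x. ?D x v)" for v
      using prod by (intro prod_span.intros smooth_fn_derivative)
    then show ?case using D frechet_derivative_at[OF D, symmetric] differentiable_def by fastforce
  next
    case (sum f g)
    let ?D = "\<lambda>x v. frechet_derivative f (at x) v + frechet_derivative g (at x) v"
    have D: "((\<lambda>x. f x + g x) has_derivative ?D x) (at x)" for x
      using sum by (intro has_derivative_add) (auto simp: frechet_derivative_works[symmetric])
    have "prod_span (\<lambda>x. ?D x v)" for v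
      using sum by (intro prod_span.intros(2)) auto
    then show ?case using D frechet_derivative_at[OF D, symmetric] differentiable_def by fastforce
  qed
  show "h differentiable (at x)" "prod_span (\<lambda>x. frechet_derivative h (at x) v)"
    if "prod_span h" for h :: "'a \<Rightarrow> 'b" and x v
    using *[OF that] by auto
qed (use assms prod_span.prod in blast)

lemma smooth_fn_const: "smooth_fn (\<lambda>x. k)"
  by (rule smooth_fn_closedI[where X = "\<lambda>h. \<exists>k. h = (\<lambda>x. k)"]) auto

lemma smooth_fn_prod:
  fixes f :: "'i \<Rightarrow> 'a::euclidean_space \<Rightarrow> 'b::{real_normed_algebra_1, comm_monoid_mult}"
  assumes "\<And>i. i \<in> I \<Longrightarrow> smooth_fn (f i)"
  shows "smooth_fn (\<lambda>x. \<Prod>i\<in>I. f i x)"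
  using assms by (induction I rule: infinite_finite_induct) (auto intro: smooth_fn_const smooth_fn_mult)

text \<open>The functions \<open>P(1/t) e\<^sup>-\<^sup>1\<^sup>/\<^sup>t\<close> with a polynomial \<open>P\<close> are closed under differentiation,
  so each of them is smooth by coinduction; \<open>P = 1\<close> yields the bump functions.\<close>
definition cutoff :: "real poly \<Rightarrow> real \<Rightarrow> real" where
  "cutoff P t = (if t > 0 then poly P (1/t) * exp (- (1/t)) else 0)"

lemma poly_mult_exp_tendsto_0:
  "((\<lambda>s. poly P s * exp (- s)) \<longlongrightarrow> (0::real)) at_top"
proof -
  have "((\<lambda>s. \<Sum>i\<le>degree P. coeff P i * (s ^ i / exp s)) \<longlongrightarrow> (\<Sum>i\<le>degree P. coeff P i * 0)) at_top"
    by (intro tendsto_intros tendsto_power_div_exp_0)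
  then show ?thesis
    by (simp add: poly_altdef exp_minus field_simps sum_divide_distrib)
qed

text \<open>With s = 1/t one has d/dt = - s^2 d/ds, and P(s) e^{-s} has the s-derivative (P' - P)(s)
  e^{-s}; the monomial is the factor s^2. At t = 0 the right difference quotient is s P(s) e^{-s},
  which vanishes as s tends to infinity, and the left one is 0.\<close>

lemma cutoff_DERIV:
  "(cutoff P has_real_derivative cutoff (monom 1 2 * (P - pderiv P)) t) (at t)"
proof -
  consider "t > 0" | "t < 0" | "t = 0" by linarith
  then show ?thesis
  proof cases
    case 1
    have "((\<lambda>t. poly P (1/t) * exp (- (1/t))) has_real_derivative
        cutoff (monom 1 2 * (P - pderiv P)) t) (at t)"
      using 1 unfolding cutoff_def
      by (auto intro!: derivative_eq_intros poly_DERIV[THEN DERIV_chain2]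
          simp: poly_monom field_simps power2_eq_square)
    then show ?thesis
      by (rule DERIV_cong_ev[THEN iffD1, rotated -1])
        (use 1 eventually_nhds_in_open[of "{0<..}" t] in \<open>auto simp: cutoff_def elim!: eventually_mono\<close>)
  next
    case 2
    have "((\<lambda>t. 0) has_real_derivative 0) (at t)" by simp
    then have "(cutoff P has_real_derivative 0) (at t)"
      by (rule DERIV_cong_ev[THEN iffD1, rotated -1])
        (use 2 eventually_nhds_in_open[of "{..<0}" t] in \<open>auto simp: cutoff_def elim!: eventually_mono\<close>)
    then show ?thesis using 2 by (simp add: cutoff_def)
  next
    case 3
    have "((\<lambda>h. cutoff P h / h) \<longlongrightarrow> 0) (at_right 0)"
    proof -
      have "((\<lambda>s. poly (pCons 0 P) s * exp (- s)) \<longlongrightarrow> 0) (at_top::real filter)"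
        by (rule poly_mult_exp_tendsto_0)
      then have "((\<lambda>h. poly (pCons 0 P) (inverse h) * exp (- inverse h)) \<longlongrightarrow> 0) (at_right (0::real))"
        by (rule filterlim_compose) (rule filterlim_inverse_at_top_right)
      then show ?thesis
        by (rule Lim_transform_eventually)
          (auto simp: cutoff_def eventually_at_filter divide_inverse mult_ac)
    qed
    moreover have "((\<lambda>h. cutoff P h / h) \<longlongrightarrow> 0) (at_left 0)"
      by (rule Lim_transform_eventually[OF tendsto_const])
        (auto simp: cutoff_def eventually_at_filter)
    ultimately have "((\<lambda>h. cutoff P h / h) \<longlongrightarrow> 0) (at 0)"
      by (simp add: filterlim_at_split)
    then show ?thesis using 3 by (simp add: DERIV_def cutoff_def)
  qed
qed

text \<open>The inner function is affine, so the chain rule only contributes the constant l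
  \<bullet> v. It is absorbed into the polynomial, and the family indexed by \<open>P\<close> alone
  is closed under derivatives.\<close>

lemma smooth_fn_cutoff:
  fixes l :: "'a::euclidean_space"
  shows "smooth_fn (\<lambda>x. cutoff P (a + l \<bullet> x))"
proof (rule smooth_fn_closedI[where X = "\<lambda>h. \<exists>P. h = (\<lambda>x. cutoff P (a + l \<bullet> x))"])
  let ?Q = "\<lambda>P. monom 1 2 * (P - pderiv P)"
  have D: "((\<lambda>x. cutoff P (a + l \<bullet> x)) has_derivative (\<lambda>v. cutoff (?Q P) (a + l \<bullet> x) * (l \<bullet> v))) (at x)" for P x
    by (rule has_derivative_compose[OF _ cutoff_DERIV[unfolded has_field_derivative_def]])
      (auto intro!: derivative_eq_intros)
  show "h differentiable at x" if "\<exists>P. h = (\<lambda>x. cutoff P (a + l \<bullet> x))" for h :: "'a \<Rightarrow> real" and x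
    using that D differentiable_def by blast
  show "\<exists>P. (\<lambda>x. frechet_derivative h (at x) v) = (\<lambda>x. cutoff P (a + l \<bullet> x))"
    if h: "\<exists>P. h = (\<lambda>x. cutoff P (a + l \<bullet> x))" for h :: "'a \<Rightarrow> real" and v
  proof -
    obtain P where P: "h = (\<lambda>x. cutoff P (a + l \<bullet> x))" using h by blast
    have "frechet_derivative h (at x) v = cutoff (smult (l \<bullet> v) (?Q P)) (a + l \<bullet> x)" for x
      unfolding P frechet_derivative_at[OF D, symmetric] by (simp add: cutoff_def)
    then show ?thesis by auto
  qed
qed blast

section \<open>Square-integrable functions\<close>

lemma borel_measurable_vec_nth [measurable (raw)]:
  fixes f :: "'a \<Rightarrow> 'b::real_normed_vector ^ 'n"
  assumes "f \<in> borel_measurable M"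
  shows "(\<lambda>x. f x $ i) \<in> borel_measurable M"
  by (rule measurable_compose[OF assms borel_measurable_continuous_onI]) (intro continuous_intros)

lemma borel_measurable_vec_lambda [measurable (raw)]:
  fixes f :: "'a \<Rightarrow> 'n::finite \<Rightarrow> 'b::euclidean_space"
  assumes "\<And>i. (\<lambda>x. f x i) \<in> borel_measurable M"
  shows "(\<lambda>x. \<chi> i. f x i) \<in> borel_measurable M"
  unfolding borel_measurable_euclidean_space[where f = "\<lambda>x. \<chi> i. f x i"]
  using assms by (auto simp: Basis_vec_def inner_axis)

lemma Re_cdot: "Re (cdot v w) = v \<bullet> w"
  by (simp add: cdot_def inner_vec_def inner_complex_def)

lemma Re_mult_cnj: "Re (z * cnj w) = z \<bullet> w"
  by (simp add: inner_complex_def)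

lemma L2_measurable: "L2 \<Omega> f \<Longrightarrow> f \<in> borel_measurable (lebesgue_on \<Omega>)"
  by (simp add: L2_def)

lemma L2_integrable: "L2 \<Omega> f \<Longrightarrow> integrable (lebesgue_on \<Omega>) (\<lambda>x. (norm (f x))\<^sup>2)"
  by (simp add: L2_def)

lemma l2norm_nonneg [simp]: "0 \<le> l2norm \<Omega> f"
  by (simp add: l2norm_def)

lemma l2norm_squared: "(l2norm \<Omega> f)\<^sup>2 = (\<integral>x. (norm (f x))\<^sup>2 \<partial>lebesgue_on \<Omega>)"
  by (simp add: l2norm_def)

lemma L2_dominated:
  assumes "L2 \<Omega> f" "h \<in> borel_measurable (lebesgue_on \<Omega>)" "0 \<le> C"
    and "AE x in lebesgue_on \<Omega>. norm (h x) \<le> C * norm (f x)"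
  shows L2_dominated_L2: "L2 \<Omega> h" and L2_dominated_norm: "l2norm \<Omega> h \<le> C * l2norm \<Omega> f"
proof -
  have le: "AE x in lebesgue_on \<Omega>. (norm (h x))\<^sup>2 \<le> C\<^sup>2 * (norm (f x))\<^sup>2"
    using assms(4)
  proof eventually_elim
    case (elim x)
    show ?case using power_mono[OF elim norm_ge_zero, of 2] by (simp add: power_mult_distrib)
  qed
  have i: "integrable (lebesgue_on \<Omega>) (\<lambda>x. C\<^sup>2 * (norm (f x))\<^sup>2)"
    using L2_integrable[OF assms(1)] by simp
  have h: "integrable (lebesgue_on \<Omega>) (\<lambda>x. (norm (h x))\<^sup>2)"
    by (rule Bochner_Integration.integrable_bound[OF i]) (use le assms(2) in auto)
  show "L2 \<Omega> h" using h assms(2) by (simp add: L2_def)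
  have "(l2norm \<Omega> h)\<^sup>2 \<le> (C * l2norm \<Omega> f)\<^sup>2"
    using integral_mono_AE[OF h i le] by (simp add: l2norm_squared power_mult_distrib)
  then show "l2norm \<Omega> h \<le> C * l2norm \<Omega> f"
    by (rule power2_le_imp_le) (simp add: assms(3))
qed

context
  fixes \<Omega> :: "(real^'n::finite) set" and f g :: "real^'n \<Rightarrow> 'b::euclidean_space"
  assumes f: "L2 \<Omega> f" and g: "L2 \<Omega> g"
begin

lemma L2_add: "L2 \<Omega> (\<lambda>x. f x + g x)"
proof -
  have [measurable]: "f \<in> borel_measurable (lebesgue_on \<Omega>)" "g \<in> borel_measurable (lebesgue_on \<Omega>)"
    using f g by (auto simp: L2_def)
  have "integrable (lebesgue_on \<Omega>) (\<lambda>x. 2 * (norm (f x))\<^sup>2 + 2 * (norm (g x))\<^sup>2)"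
    using f g by (auto simp: L2_def)
  moreover have "(norm (f x + g x))\<^sup>2 \<le> 2 * (norm (f x))\<^sup>2 + 2 * (norm (g x))\<^sup>2" for x
    using zero_le_power2[of "norm (f x - g x)"] by (simp add: power2_norm_eq_inner inner_simps inner_commute)
  ultimately have "integrable (lebesgue_on \<Omega>) (\<lambda>x. (norm (f x + g x))\<^sup>2)"
    by (intro Bochner_Integration.integrable_bound[where g = "\<lambda>x. (norm (f x + g x))\<^sup>2"] AE_I2) auto
  then show ?thesis by (simp add: L2_def)
qed

lemma L2_inner: "integrable (lebesgue_on \<Omega>) (\<lambda>x. f x \<bullet> g x)"
proof -
  have [measurable]: "f \<in> borel_measurable (lebesgue_on \<Omega>)" "g \<in> borel_measurable (lebesgue_on \<Omega>)"
    using f g by (auto simp: L2_def)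
  have "integrable (lebesgue_on \<Omega>) (\<lambda>x. (norm (f x))\<^sup>2 + (norm (g x))\<^sup>2)"
    using f g by (auto simp: L2_def)
  moreover have "\<bar>f x \<bullet> g x\<bar> \<le> (norm (f x))\<^sup>2 + (norm (g x))\<^sup>2" for x
    using Cauchy_Schwarz_ineq2[of "f x" "g x"] sum_squares_bound[of "norm (f x)" "norm (g x)"]
      mult_nonneg_nonneg[of "norm (f x)" "norm (g x)"] by linarith
  ultimately show ?thesis
    by (intro Bochner_Integration.integrable_bound[where g = "\<lambda>x. f x \<bullet> g x"] AE_I2) auto
qed

end

lemma L2_minus:
  fixes f :: "real^'n::finite \<Rightarrow> 'b::euclidean_space"
  shows "L2 \<Omega> f \<Longrightarrow> L2 \<Omega> (\<lambda>x. - f x)"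
  by (auto simp: L2_def)

lemma L2_diff:
  fixes f g :: "real^'n::finite \<Rightarrow> 'b::euclidean_space"
  shows "L2 \<Omega> f \<Longrightarrow> L2 \<Omega> g \<Longrightarrow> L2 \<Omega> (\<lambda>x. f x - g x)"
  using L2_add[OF _ L2_minus, of \<Omega> f g] by simp

text \<open>The squared norm of f - t g is a nonnegative quadratic in t; evaluating it at its
  minimizer gives the bound.\<close>

lemma l2norm_Cauchy_Schwarz:
  fixes f g :: "real^'n::finite \<Rightarrow> 'b::euclidean_space"
  assumes f: "L2 \<Omega> f" and g: "L2 \<Omega> g"
  shows "\<bar>\<integral>x. f x \<bullet> g x \<partial>lebesgue_on \<Omega>\<bar> \<le> l2norm \<Omega> f * l2norm \<Omega> g"
proof -
  let ?b = "\<integral>x. f x \<bullet> g x \<partial>lebesgue_on \<Omega>"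
  have q: "0 \<le> (l2norm \<Omega> f)\<^sup>2 - 2 * t * ?b + t\<^sup>2 * (l2norm \<Omega> g)\<^sup>2" for t
  proof -
    have "0 \<le> (\<integral>x. (norm (f x - t *\<^sub>R g x))\<^sup>2 \<partial>lebesgue_on \<Omega>)" by simp
    also have "\<dots> = (\<integral>x. (norm (f x))\<^sup>2 - 2 * t * (f x \<bullet> g x) + t\<^sup>2 * (norm (g x))\<^sup>2 \<partial>lebesgue_on \<Omega>)"
      by (simp only: power2_norm_eq_inner power2_eq_square[of t])
        (simp add: inner_simps inner_commute algebra_simps)
    also have "\<dots> = (l2norm \<Omega> f)\<^sup>2 - 2 * t * ?b + t\<^sup>2 * (l2norm \<Omega> g)\<^sup>2"
      using f g L2_inner[OF f g] by (simp add: l2norm_squared L2_integrable)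
    finally show ?thesis .
  qed
  have "?b\<^sup>2 \<le> (l2norm \<Omega> f * l2norm \<Omega> g)\<^sup>2"
  proof (cases "l2norm \<Omega> g = 0")
    case True
    have "?b = 0"
    proof (rule ccontr)
      assume "?b \<noteq> 0"
      \<comment> \<open>Here the leading coefficient vanishes and the expression is affine in t;
        this t gives it the value -1.\<close>
      then show False using q[of "((l2norm \<Omega> f)\<^sup>2 + 1) / (2 * ?b)"] True by simp
    qed
    then show ?thesis by simp
  next
    case False
    have e: "f2 - 2 * (B / g2) * B + (B / g2)\<^sup>2 * g2 = f2 - B\<^sup>2 / g2" if "g2 \<noteq> 0" for f2 g2 B :: real
      using that by (simp add: field_simps power2_eq_square)
    have "0 < (l2norm \<Omega> g)\<^sup>2" using False by simp
    then show ?thesis using q[of "?b / (l2norm \<Omega> g)\<^sup>2"] False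
      by (simp only: e) (simp add: field_simps power_mult_distrib)
  qed
  then show ?thesis by (simp add: abs_le_square_iff[symmetric] abs_mult)
qed

lemma l2norm_triangle_diff:
  fixes f g :: "real^'n::finite \<Rightarrow> 'b::euclidean_space"
  assumes f: "L2 \<Omega> f" and g: "L2 \<Omega> g"
  shows "l2norm \<Omega> (\<lambda>x. f x - g x) \<le> l2norm \<Omega> f + l2norm \<Omega> g"
proof (rule power2_le_imp_le)
  have "(l2norm \<Omega> (\<lambda>x. f x - g x))\<^sup>2
      = (\<integral>x. (norm (f x))\<^sup>2 - 2 * (f x \<bullet> g x) + (norm (g x))\<^sup>2 \<partial>lebesgue_on \<Omega>)"
    unfolding l2norm_squared power2_norm_eq_inner by (simp add: inner_simps inner_commute algebra_simps)
  also have "\<dots> = (l2norm \<Omega> f)\<^sup>2 - 2 * (\<integral>x. f x \<bullet> g x \<partial>lebesgue_on \<Omega>) + (l2norm \<Omega> g)\<^sup>2"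
    using f g L2_inner[OF f g] by (simp add: l2norm_squared L2_integrable)
  also have "\<dots> \<le> (l2norm \<Omega> f + l2norm \<Omega> g)\<^sup>2"
    using l2norm_Cauchy_Schwarz[OF f g] unfolding power2_sum by linarith
  finally show "(l2norm \<Omega> (\<lambda>x. f x - g x))\<^sup>2 \<le> (l2norm \<Omega> f + l2norm \<Omega> g)\<^sup>2" .
qed simp

text \<open>This carries the integral identities from test functions to their limits. The difference
  of the products is split as (F - f)(G - g) + (F - f) g + f (G - g), so that no bound on the norms
  of \<open>F k\<close> and \<open>G k\<close> has to be found.\<close>

lemma l2norm_tendsto_inner:
  fixes F :: "nat \<Rightarrow> real^'n::finite \<Rightarrow> 'b::euclidean_space"
  assumes L2: "\<And>k. L2 \<Omega> (F k)" "\<And>k. L2 \<Omega> (G k)" "L2 \<Omega> f" "L2 \<Omega> g"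
    and F: "(\<lambda>k. l2norm \<Omega> (\<lambda>x. F k x - f x)) \<longlonglongrightarrow> 0"
    and G: "(\<lambda>k. l2norm \<Omega> (\<lambda>x. G k x - g x)) \<longlonglongrightarrow> 0"
  shows "(\<lambda>k. \<integral>x. F k x \<bullet> G k x \<partial>lebesgue_on \<Omega>) \<longlonglongrightarrow> (\<integral>x. f x \<bullet> g x \<partial>lebesgue_on \<Omega>)"
proof -
  let ?I = "\<lambda>f g. \<integral>x. f x \<bullet> g x \<partial>lebesgue_on \<Omega>"
  let ?a = "\<lambda>k. l2norm \<Omega> (\<lambda>x. F k x - f x)" and ?b = "\<lambda>k. l2norm \<Omega> (\<lambda>x. G k x - g x)"
  have *: "norm (?I (F k) (G k) - ?I f g) \<le> ?a k * ?b k + ?a k * l2norm \<Omega> g + l2norm \<Omega> f * ?b k" for k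
  proof -
    note d = L2_diff[OF L2(1)[of k] L2(3)] L2_diff[OF L2(2)[of k] L2(4)]
    have "?I (F k) (G k) - ?I f g = (\<integral>x. F k x \<bullet> G k x - f x \<bullet> g x \<partial>lebesgue_on \<Omega>)"
      using L2 by (simp add: L2_inner)
    also have "\<dots> = (\<integral>x. (F k x - f x) \<bullet> (G k x - g x) + (F k x - f x) \<bullet> g x
        + f x \<bullet> (G k x - g x) \<partial>lebesgue_on \<Omega>)"
      by (simp add: inner_simps)
    also have "\<dots> = ?I (\<lambda>x. F k x - f x) (\<lambda>x. G k x - g x) + ?I (\<lambda>x. F k x - f x) g
        + ?I f (\<lambda>x. G k x - g x)"
      using L2 d by (simp add: L2_inner)
    finally show ?thesis
      using l2norm_Cauchy_Schwarz[OF d] l2norm_Cauchy_Schwarz[OF d(1) L2(4)]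
        l2norm_Cauchy_Schwarz[OF L2(3) d(2)] by simp
  qed
  have "(\<lambda>k. ?a k * ?b k + ?a k * l2norm \<Omega> g + l2norm \<Omega> f * ?b k) \<longlonglongrightarrow>
      0 * 0 + 0 * l2norm \<Omega> g + l2norm \<Omega> f * 0"
    by (intro tendsto_intros F G)
  then have "(\<lambda>k. ?I (F k) (G k) - ?I f g) \<longlonglongrightarrow> 0"
    by (intro Lim_null_comparison[OF always_eventually[OF allI[OF *]]]) simp
  then show ?thesis by (simp add: LIM_zero_iff)
qed

section \<open>Test functions\<close>

lemma smooth_fn_continuous_on: "smooth_fn f \<Longrightarrow> continuous_on S f"
  by (intro continuous_at_imp_continuous_on ballI differentiable_imp_continuous_within
      smooth_fn_differentiable)

lemma pd_has_derivative:
  assumes "test_fn \<Omega> \<phi>"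
  shows "(\<phi> has_derivative frechet_derivative \<phi> (at x)) (at x)"
  using smooth_fn_differentiable[of \<phi> x] assms by (simp add: test_fn_def frechet_derivative_works)

lemma pd_eqI: "(\<phi> has_derivative D) (at x) \<Longrightarrow> pd i \<phi> x = D (axis i 1)"
  by (simp add: pd_def frechet_derivative_at[symmetric])

text \<open>The inclusion is into the closure because a derivative of \<phi> may be nonzero at a
  zero of \<phi>.\<close>

lemma test_fn_mono:
  assumes "test_fn \<Omega> \<phi>" "smooth_fn \<psi>" "{x. \<psi> x \<noteq> 0} \<subseteq> closure {x. \<phi> x \<noteq> 0}"
  shows "test_fn \<Omega> \<psi>"
proof -
  have "closure {x. \<psi> x \<noteq> 0} \<subseteq> closure {x. \<phi> x \<noteq> 0}"
    using closure_mono[OF assms(3)] by simp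
  then show ?thesis
    using assms compact_Int_closed[OF _ closed_closure, of "closure {x. \<phi> x \<noteq> 0}" "{x. \<psi> x \<noteq> 0}"]
    by (auto simp: test_fn_def Int_absorb1)
qed

lemma test_fn_pd:
  assumes "test_fn \<Omega> \<phi>" shows "test_fn \<Omega> (pd i \<phi>)"
proof (rule test_fn_mono[OF assms])
  show "smooth_fn (pd i \<phi>)"
    using assms smooth_fn_derivative[of \<phi> "axis i 1"] by (simp add: test_fn_def pd_def[abs_def])
  show "{x. pd i \<phi> x \<noteq> 0} \<subseteq> closure {x. \<phi> x \<noteq> 0}"
  proof (rule subsetI, rule ccontr)
    fix x assume x: "x \<in> {x. pd i \<phi> x \<noteq> 0}" "x \<notin> closure {x. \<phi> x \<noteq> 0}"
    have "((\<lambda>x. 0) has_derivative (\<lambda>v. 0)) (at x)" by simp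
    then have "(\<phi> has_derivative (\<lambda>v. 0)) (at x)"
      by (rule has_derivative_transform_within_open[of _ _ _ _ "- closure {x. \<phi> x \<noteq> 0}"])
        (use x closure_subset[of "{x. \<phi> x \<noteq> 0}"] in auto)
    from pd_eqI[OF this] show False using x by simp
  qed
qed

lemma test_fn_cnj: "test_fn \<Omega> \<phi> \<Longrightarrow> test_fn \<Omega> (\<lambda>x. cnj (\<phi> x))"
  using smooth_fn_bounded_linear[OF bounded_linear_cnj] by (auto simp: test_fn_def)

lemma pd_cnj: "test_fn \<Omega> \<phi> \<Longrightarrow> pd i (\<lambda>x. cnj (\<phi> x)) x = cnj (pd i \<phi> x)"
  using pd_eqI[OF bounded_linear.has_derivative[OF bounded_linear_cnj pd_has_derivative]]
  by (simp add: pd_def)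

lemma test_fn_mult:
  assumes "test_fn \<Omega> \<phi>" "test_fn \<Omega> \<psi>"
  shows "test_fn \<Omega> (\<lambda>x. \<phi> x * \<psi> x)"
  using assms closure_subset[of "{x. \<phi> x \<noteq> 0}"]
  by (intro test_fn_mono[OF assms(1)] smooth_fn_mult) (auto simp: test_fn_def)

lemma pd_mult:
  "test_fn \<Omega> \<phi> \<Longrightarrow> test_fn \<Omega> \<psi> \<Longrightarrow>
    pd i (\<lambda>x. \<phi> x * \<psi> x) x = \<phi> x * pd i \<psi> x + pd i \<phi> x * \<psi> x"
  using pd_eqI[OF has_derivative_mult[OF pd_has_derivative pd_has_derivative]]
  by (simp add: pd_def)

lemma test_fn_diff:
  assumes "test_fn \<Omega> \<phi>" "test_fn \<Omega> \<psi>"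
  shows "test_fn \<Omega> (\<lambda>x. \<phi> x - \<psi> x)"
proof -
  let ?K = "closure {x. \<phi> x \<noteq> 0} \<union> closure {x. \<psi> x \<noteq> 0}"
  have K: "compact ?K" "?K \<subseteq> \<Omega>" using assms by (auto simp: test_fn_def)
  have "closure {x. \<phi> x - \<psi> x \<noteq> 0} \<subseteq> ?K"
    using closure_subset[of "{x. \<phi> x \<noteq> 0}"] closure_subset[of "{x. \<psi> x \<noteq> 0}"]
    by (intro closure_minimal closed_Un closed_closure) force
  then show ?thesis
    using K compact_Int_closed[OF K(1) closed_closure, of "{x. \<phi> x - \<psi> x \<noteq> 0}"] assms
    by (auto simp: test_fn_def Int_absorb1 intro: smooth_fn_diff)
qed

lemma cgrad_diff:
  "test_fn \<Omega> \<phi> \<Longrightarrow> test_fn \<Omega> \<psi> \<Longrightarrow> cgrad (\<lambda>x. \<phi> x - \<psi> x) x = cgrad \<phi> x - cgrad \<psi> x"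
  using pd_eqI[OF has_derivative_diff[OF pd_has_derivative[of \<Omega> \<phi>] pd_has_derivative[of \<Omega> \<psi>]]]
  by (simp add: cgrad_def vec_eq_iff pd_def[of _ \<phi>] pd_def[of _ \<psi>])

lemma integrable_indicator_lebesgue_on:
  assumes "K \<in> lmeasurable" "K \<subseteq> \<Omega>" "\<Omega> \<in> sets lebesgue"
  shows "integrable (lebesgue_on \<Omega>) (indicator K :: _ \<Rightarrow> real)"
proof -
  have "integrable lebesgue (indicator K :: _ \<Rightarrow> real)"
    using fmeasurableD2[OF assms(1)] assms(1)
    by (simp add: integrable_indicator_iff less_top fmeasurable_def)
  moreover have "(indicator K :: _ \<Rightarrow> real) = (\<lambda>x. indicator \<Omega> x *\<^sub>R indicator K x)"
    using assms(2) by (auto simp: indicator_def fun_eq_iff)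
  ultimately show ?thesis
    using assms(3) by (subst integrable_restrict_space) auto
qed

lemma test_fn_L2:
  assumes "test_fn \<Omega> \<phi>" "open \<Omega>"
  shows "L2 \<Omega> \<phi>"
proof -
  define K where "K = closure {x. \<phi> x \<noteq> 0}"
  have K: "compact K" "K \<subseteq> \<Omega>" and c: "continuous_on UNIV \<phi>"
    using assms smooth_fn_continuous_on by (auto simp: test_fn_def K_def)
  have m: "\<phi> \<in> borel_measurable (lebesgue_on \<Omega>)"
    using borel_measurable_continuous_onI[OF c]
    by (simp add: measurable_completion measurable_restrict_space1)
  obtain B where B: "\<And>x. x \<in> K \<Longrightarrow> norm (\<phi> x) \<le> B"
    using compact_imp_bounded[OF compact_continuous_image[OF continuous_on_subset[OF c] K(1)]]
    unfolding bounded_iff by auto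
  have i: "integrable (lebesgue_on \<Omega>) (\<lambda>x. indicator K x * B\<^sup>2)"
    using integrable_indicator_lebesgue_on[OF lmeasurable_compact[OF K(1)] K(2)] assms(2)
    by (intro integrable_mult_left) auto
  have "(norm (\<phi> x))\<^sup>2 \<le> indicator K x * B\<^sup>2" for x
    using B[of x] closure_subset[of "{x. \<phi> x \<noteq> 0}"] power_mono[of "norm (\<phi> x)" B 2]
    by (cases "x \<in> K") (auto simp: K_def)
  then have "integrable (lebesgue_on \<Omega>) (\<lambda>x. (norm (\<phi> x))\<^sup>2)"
    using m by (intro Bochner_Integration.integrable_bound[OF i]) auto
  then show ?thesis using m by (simp add: L2_def)
qed

lemma cgrad_L2:
  assumes "test_fn \<Omega> \<phi>" "open \<Omega>" shows "L2 \<Omega> (cgrad \<phi>)"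
proof -
  have L2: "L2 \<Omega> (pd i \<phi>)" for i
    using test_fn_L2[OF test_fn_pd[OF assms(1)] assms(2)] .
  have "integrable (lebesgue_on \<Omega>) (\<lambda>x. \<Sum>i\<in>UNIV. (norm (pd i \<phi> x))\<^sup>2)"
    using L2 by (auto simp: L2_def)
  moreover have "(norm (cgrad \<phi> x))\<^sup>2 = (\<Sum>i\<in>UNIV. (norm (pd i \<phi> x))\<^sup>2)" for x
    by (simp add: norm_vec_def L2_set_def cgrad_def sum_nonneg)
  moreover have "cgrad \<phi> \<in> borel_measurable (lebesgue_on \<Omega>)"
    unfolding cgrad_def[abs_def] using L2 by (intro borel_measurable_vec_lambda) (auto simp: L2_def)
  ultimately show ?thesis by (simp add: L2_def)
qed

section \<open>The fundamental lemma of the calculus of variations\<close>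

text \<open>For t > 0 the value exp(-1/(k t)) tends to 1 as k grows, and for t \<le> 0 the cutoff is
  0. Scaling the argument by \<open>Suc k\<close> thus sharpens the bump while the set where it is
  nonzero stays exactly the open box, and the indicator of the box dominates all the bumps.\<close>

definition box_bump :: "real^'n \<Rightarrow> real^'n \<Rightarrow> nat \<Rightarrow> real^'n \<Rightarrow> complex" where
  "box_bump a b k x = complex_of_real (\<Prod>i\<in>UNIV.
      cutoff 1 (real (Suc k) * (x $ i - a $ i)) * cutoff 1 (real (Suc k) * (b $ i - x $ i)))"

lemma cutoff_1_bounds: "0 \<le> cutoff 1 t" "cutoff 1 t \<le> 1" "cutoff 1 t = 0 \<longleftrightarrow> t \<le> 0"
  by (auto simp: cutoff_def)

lemma box_bump_eq_0_iff: "box_bump a b k x = 0 \<longleftrightarrow> x \<notin> box a b"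
proof -
  have "box_bump a b k x = 0 \<longleftrightarrow> (\<exists>i. x $ i \<le> a $ i \<or> b $ i \<le> x $ i)"
    by (simp add: box_bump_def cutoff_1_bounds mult_le_0_iff)
  then show ?thesis by (simp add: mem_box_cart not_less de_Morgan_conj)
qed

lemma norm_box_bump_le: "norm (box_bump a b k x) \<le> indicator (box a b) x"
proof (cases "x \<in> box a b")
  case True
  have "(\<Prod>i\<in>UNIV. cutoff 1 (real (Suc k) * (x $ i - a $ i)) * cutoff 1 (real (Suc k) * (b $ i - x $ i))) \<le> 1"
    by (intro prod_le_1 conjI mult_nonneg_nonneg mult_le_one cutoff_1_bounds)
  then show ?thesis using True
    by (simp add: box_bump_def abs_of_nonneg prod_nonneg cutoff_1_bounds del: of_real_prod of_real_mult)
qed (simp add: box_bump_eq_0_iff[THEN iffD2])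

lemma box_bump_tendsto: "(\<lambda>k. box_bump a b k x) \<longlonglongrightarrow> indicator (box a b) x"
proof (cases "x \<in> box a b")
  case True
  have *: "(\<lambda>k. cutoff 1 (real (Suc k) * t)) \<longlonglongrightarrow> 1" if "t > 0" for t
  proof -
    have "(\<lambda>k. exp (- (inverse t * inverse (real (Suc k))))) \<longlonglongrightarrow> exp (- (inverse t * 0))"
      by (intro tendsto_intros LIMSEQ_inverse_real_of_nat)
    then show ?thesis using that by (simp add: cutoff_def divide_inverse mult_ac)
  qed
  have "(\<lambda>k. box_bump a b k x) \<longlonglongrightarrow> complex_of_real (\<Prod>i\<in>(UNIV::'a set). 1 * 1)"
    unfolding box_bump_def using True
    by (intro tendsto_of_real tendsto_prod tendsto_mult *) (auto simp: mem_box_cart)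
  then show ?thesis using True by simp
qed (simp add: box_bump_eq_0_iff[THEN iffD2])

lemma test_fn_box_bump:
  assumes "cbox a b \<subseteq> \<Omega>"
  shows "test_fn \<Omega> (box_bump a b k)"
proof -
  have 1: "smooth_fn (\<lambda>x::real^'a. cutoff 1 (real (Suc k) * (x $ i - a $ i)))" for i
    using smooth_fn_cutoff[of 1 "- (real (Suc k) * a $ i)" "real (Suc k) *\<^sub>R (axis i 1 :: real^'a)"]
    by (simp add: inner_axis' algebra_simps)
  have 2: "smooth_fn (\<lambda>x::real^'a. cutoff 1 (real (Suc k) * (b $ i - x $ i)))" for i
    using smooth_fn_cutoff[of 1 "real (Suc k) * b $ i" "- (real (Suc k) *\<^sub>R (axis i 1 :: real^'a))"]
    by (simp add: inner_axis' algebra_simps)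
  have "smooth_fn (box_bump a b k)"
    unfolding box_bump_def[abs_def]
    by (intro smooth_fn_bounded_linear[OF bounded_linear_of_real] smooth_fn_prod smooth_fn_mult 1 2)
  moreover have "closure {x. box_bump a b k x \<noteq> 0} \<subseteq> cbox a b"
    by (intro closure_minimal) (auto simp: box_bump_eq_0_iff intro: box_subset_cbox[THEN subsetD])
  moreover from this have "compact (closure {x. box_bump a b k x \<noteq> 0})"
    using bounded_subset[OF bounded_cbox] compact_eq_bounded_closed by blast
  ultimately show ?thesis using assms by (auto simp: test_fn_def)
qed

text \<open>The domain may have infinite measure, where square integrability does not give
  integrability. On a set of finite measure it does, by |g| \<le> |g|^2 + 1.\<close>

lemma L2_indicator_integrable:
  fixes g :: "real^'n::finite \<Rightarrow> complex"
  assumes g: "L2 \<Omega> g" and \<Omega>: "open \<Omega>" and S: "S \<in> lmeasurable"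
  shows "integrable (lebesgue_on \<Omega>) (\<lambda>x. indicator S x *\<^sub>R g x)"
proof -
  have S': "S \<inter> \<Omega> \<in> lmeasurable" and \<Omega>': "\<Omega> \<in> sets lebesgue"
    using S \<Omega> by (auto intro: fmeasurable_Int_fmeasurable)
  have "integrable (lebesgue_on \<Omega>) (\<lambda>x. (norm (g x))\<^sup>2 + indicator (S \<inter> \<Omega>) x)"
    using L2_integrable[OF g] integrable_indicator_lebesgue_on[OF S' _ \<Omega>'] by auto
  moreover have "(\<lambda>x. indicator S x *\<^sub>R g x) \<in> borel_measurable (lebesgue_on \<Omega>)"
    using S
    by (intro borel_measurable_scaleR L2_measurable[OF g] measurable_restrict_space1 borel_measurable_indicator)
       (auto simp: fmeasurable_def)
  moreover have "norm (indicator S x *\<^sub>R g x) \<le> norm ((norm (g x))\<^sup>2 + indicator (S \<inter> \<Omega>) x :: real)"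
    if "x \<in> \<Omega>" for x
  proof -
    have "norm (g x) \<le> (norm (g x))\<^sup>2 + 1"
      using sum_squares_bound[of "norm (g x)" 1] norm_ge_zero[of "g x"] by (simp del: norm_ge_zero)
    then show ?thesis using that by (auto simp: indicator_def)
  qed
  ultimately show ?thesis
    by (intro Bochner_Integration.integrable_bound[where g = "\<lambda>x. indicator S x *\<^sub>R g x"] AE_I2) auto
qed

text \<open>Bump functions converge boundedly to indicators of boxes, so \<open>g\<close> has integral zero over every
  box in the domain, and Lebesgue differentiation applies.\<close>
lemma L2_eq_0_AE:
  fixes g :: "real^'n::finite \<Rightarrow> complex"
  assumes g: "L2 \<Omega> g" and \<Omega>: "open \<Omega>"
    and 0: "\<And>\<phi>. test_fn \<Omega> \<phi> \<Longrightarrow> (\<integral>x. g x * \<phi> x \<partial>lebesgue_on \<Omega>) = 0"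
  shows "AE x in lebesgue_on \<Omega>. g x = 0"
proof -
  have \<Omega>': "\<Omega> \<in> sets lebesgue" using \<Omega> by auto
  have box: "(\<integral>x. indicator (box a b) x *\<^sub>R g x \<partial>lebesgue_on \<Omega>) = 0" if ab: "cbox a b \<subseteq> \<Omega>" for a b
  proof -
    have "(\<lambda>k. \<integral>x. g x * box_bump a b k x \<partial>lebesgue_on \<Omega>) \<longlonglongrightarrow>
        (\<integral>x. indicator (box a b) x *\<^sub>R g x \<partial>lebesgue_on \<Omega>)"
    proof (rule integral_dominated_convergence)
      show "integrable (lebesgue_on \<Omega>) (\<lambda>x. norm (indicator (box a b) x *\<^sub>R g x))"
        by (intro integrable_norm L2_indicator_integrable[OF g \<Omega>]) simp
      show "(\<lambda>x. indicator (box a b) x *\<^sub>R g x) \<in> borel_measurable (lebesgue_on \<Omega>)"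
        by (intro borel_measurable_integrable L2_indicator_integrable[OF g \<Omega>]) simp
      show "(\<lambda>x. g x * box_bump a b k x) \<in> borel_measurable (lebesgue_on \<Omega>)" for k
        using L2_measurable[OF g] L2_measurable[OF test_fn_L2[OF test_fn_box_bump[OF ab] \<Omega>]]
        by (rule borel_measurable_times)
      have "(\<lambda>k. g x * box_bump a b k x) \<longlonglongrightarrow> indicator (box a b) x *\<^sub>R g x" for x
        using tendsto_mult[OF tendsto_const box_bump_tendsto, of "g x" a b x]
        by (cases "x \<in> box a b") auto
      then show "AE x in lebesgue_on \<Omega>. (\<lambda>k. g x * box_bump a b k x) \<longlonglongrightarrow> indicator (box a b) x *\<^sub>R g x"
        by simp
      have "norm (g x * box_bump a b k x) \<le> norm (indicator (box a b) x *\<^sub>R g x)" for x k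
        using norm_box_bump_le[of a b k x] mult_left_mono[OF _ norm_ge_zero, of _ _ "g x"]
        by (fastforce simp: norm_mult indicator_def split: if_splits)
      then show "AE x in lebesgue_on \<Omega>. norm (g x * box_bump a b k x) \<le> norm (indicator (box a b) x *\<^sub>R g x)" for k
        by simp
    qed
    then show ?thesis
      using 0[OF test_fn_box_bump[OF ab]] by (simp add: LIMSEQ_const_iff)
  qed
  \<comment> \<open>Extension by zero: the differentiation theorem is stated for functions on the
    whole space that are gauge integrable on every box.\<close>
  define G where "G = (\<lambda>x. indicator \<Omega> x *\<^sub>R g x)"
  have G_int: "integrable lebesgue (\<lambda>x. indicator S x *\<^sub>R G x)" if "S \<in> lmeasurable" for S
    using L2_indicator_integrable[OF g \<Omega> that] \<Omega>'
    by (simp add: G_def integrable_restrict_space scaleR_left_commute mult.commute)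
  have "G integrable_on cbox a b" for a b
    using G_int[of "cbox a b"] by (intro set_lebesgue_integral_eq_integral(1)) (simp add: set_integrable_def)
  then obtain N where N: "negligible N" and lim:
    "\<And>x e. x \<notin> N \<Longrightarrow> 0 < e \<Longrightarrow> \<exists>d>0. \<forall>h. 0 < h \<and> h < d \<longrightarrow>
        norm (integral (cbox x (x + h *\<^sub>R One)) G /\<^sub>R h ^ DIM(real^'n) - G x) < e"
    using integrable_ccontinuous_explicit[of G] by blast
  have int_0: "integral (cbox a b) G = 0" if "cbox a b \<subseteq> \<Omega>" for a b
  proof -
    have "integral (cbox a b) G = integral (box a b) G"
      by (simp add: integral_open_interval)
    also have "\<dots> = (\<integral>x. indicator (box a b) x *\<^sub>R G x \<partial>lebesgue)"
      using set_lebesgue_integral_eq_integral(2)[of "box a b" G] G_int[of "box a b"]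
      by (simp add: set_integrable_def set_lebesgue_integral_def)
    also have "\<dots> = (\<integral>x. indicator (box a b) x *\<^sub>R g x \<partial>lebesgue_on \<Omega>)"
      using \<Omega>' by (simp add: G_def integral_restrict_space scaleR_left_commute mult.commute)
    finally show ?thesis using box[OF that] by simp
  qed
  have "g x = 0" if x: "x \<in> \<Omega>" "x \<notin> N" for x
  proof -
    obtain r where r: "r > 0" "ball x r \<subseteq> \<Omega>" using \<Omega> x(1) open_contains_ball by blast
    have "norm (G x) \<le> e" if e: "e > 0" for e
    proof -
      obtain d where d: "d > 0" "\<And>h. 0 < h \<Longrightarrow> h < d \<Longrightarrow>
          norm (integral (cbox x (x + h *\<^sub>R One)) G /\<^sub>R h ^ DIM(real^'n) - G x) < e"
        using lim[OF x(2) e] by blast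
      \<comment> \<open>The cube with corner x and side h lies within distance h |One| of x, so h
        \<le> r/(2 D) keeps it inside the ball. The summand 1 makes positivity of \<open>D\<close>
        immediate and the division safe.\<close>
      define D where "D = norm (One :: real^'n) + 1"
      have D: "D > 0" unfolding D_def by (simp add: add_nonneg_pos)
      define h where "h = min (d / 2) (r / (2 * D))"
      have h: "h > 0" "h < d" "h \<le> r / (2 * D)" using d(1) r(1) D by (auto simp: h_def)
      have "cbox x (x + h *\<^sub>R One) \<subseteq> ball x r"
      proof
        fix y assume "y \<in> cbox x (x + h *\<^sub>R One)"
        then have "norm (y - x) \<le> norm (h *\<^sub>R (One :: real^'n))"
          by (intro norm_le_componentwise) (auto simp: mem_box inner_simps)
        also have "\<dots> \<le> h * D" using h(1) by (simp add: D_def)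
        also have "\<dots> \<le> r / 2" using h(3) D by (simp add: field_simps)
        also have "\<dots> < r" using r(1) by simp
        finally show "y \<in> ball x r" by (simp add: dist_norm norm_minus_commute)
      qed
      then have "integral (cbox x (x + h *\<^sub>R One)) G = 0" using r(2) by (intro int_0) blast
      then show ?thesis using d(2)[OF h(1,2)] by simp
    qed
    then have "norm (G x) \<le> 0" by (rule field_le_epsilon) auto
    then show ?thesis using x(1) by (simp add: G_def)
  qed
  moreover have "AE x in lebesgue. x \<notin> N"
    using N by (intro AE_not_in) (simp add: negligible_iff_null_sets)
  ultimately show ?thesis
    using \<Omega>' by (auto simp: AE_restrict_space_iff elim!: eventually_mono)
qed

section \<open>Integration by parts\<close>

lemma L2_mult_integrable:
  fixes f g :: "real^'n::finite \<Rightarrow> complex"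
  assumes "L2 \<Omega> f" "L2 \<Omega> g"
  shows "integrable (lebesgue_on \<Omega>) (\<lambda>x. f x * g x)"
proof -
  have "integrable (lebesgue_on \<Omega>) (\<lambda>x. (norm (f x))\<^sup>2 + (norm (g x))\<^sup>2)"
    using assms by (auto simp: L2_def)
  moreover have "norm (f x) * norm (g x) \<le> (norm (f x))\<^sup>2 + (norm (g x))\<^sup>2" for x
    using sum_squares_bound[of "norm (f x)" "norm (g x)"]
      mult_nonneg_nonneg[OF norm_ge_zero[of "f x"] norm_ge_zero[of "g x"]] by linarith
  then have "norm (f x * g x) \<le> norm ((norm (f x))\<^sup>2 + (norm (g x))\<^sup>2)" for x
    by (simp add: norm_mult)
  ultimately show ?thesis
    using borel_measurable_times[OF assms[THEN L2_measurable]]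
    by (intro Bochner_Integration.integrable_bound[where g = "\<lambda>x. f x * g x"] AE_I2)
qed

lemma L2_nth:
  fixes f :: "real^'n::finite \<Rightarrow> complex^'m"
  assumes "L2 \<Omega> f" shows "L2 \<Omega> (\<lambda>x. f x $ i)"
  by (rule L2_dominated_L2[OF assms, of _ 1])
    (use borel_measurable_vec_nth[OF L2_measurable[OF assms]] Finite_Cartesian_Product.norm_nth_le in auto)

lemma L2_cnj: "L2 \<Omega> f \<Longrightarrow> L2 \<Omega> (\<lambda>x. cnj (f x))"
  using measurable_compose[OF _ borel_measurable_continuous_onI[OF continuous_on_cnj[OF continuous_on_id]]]
  by (auto simp: L2_def)

lemma weak_grad_unique:
  assumes \<Omega>: "open \<Omega>" and "L2 \<Omega> g" "weak_grad \<Omega> u g" "L2 \<Omega> h" "weak_grad \<Omega> u h"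
  shows "AE x in lebesgue_on \<Omega>. g x = h x"
proof -
  have "AE x in lebesgue_on \<Omega>. g x $ i - h x $ i = 0" for i
  proof (rule L2_eq_0_AE[OF _ \<Omega>])
    show "L2 \<Omega> (\<lambda>x. g x $ i - h x $ i)" using assms by (intro L2_diff L2_nth)
    show "(\<integral>x. (g x $ i - h x $ i) * \<phi> x \<partial>lebesgue_on \<Omega>) = 0" if \<phi>: "test_fn \<Omega> \<phi>" for \<phi>
    proof -
      have "(\<integral>x. (g x $ i - h x $ i) * \<phi> x \<partial>lebesgue_on \<Omega>) =
          (\<integral>x. g x $ i * \<phi> x \<partial>lebesgue_on \<Omega>) - (\<integral>x. h x $ i * \<phi> x \<partial>lebesgue_on \<Omega>)"
        unfolding left_diff_distrib
        by (intro Bochner_Integration.integral_diff L2_mult_integrable L2_nth test_fn_L2[OF \<phi> \<Omega>] assms)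
      moreover have "(\<integral>x. u x * pd i \<phi> x \<partial>lebesgue_on \<Omega>) = - (\<integral>x. g x $ i * \<phi> x \<partial>lebesgue_on \<Omega>)"
        "(\<integral>x. u x * pd i \<phi> x \<partial>lebesgue_on \<Omega>) = - (\<integral>x. h x $ i * \<phi> x \<partial>lebesgue_on \<Omega>)"
        using assms(3,5) \<phi> by (simp_all add: weak_grad_def)
      ultimately show ?thesis by simp
    qed
  qed
  then have "AE x in lebesgue_on \<Omega>. \<forall>i. g x $ i - h x $ i = 0"
    by (simp add: AE_all_countable)
  then show ?thesis by eventually_elim (simp add: vec_eq_iff)
qed

lemma l2norm_cong_AE:
  fixes f g :: "real^'n::finite \<Rightarrow> 'b::euclidean_space"
  assumes "f \<in> borel_measurable (lebesgue_on \<Omega>)" "g \<in> borel_measurable (lebesgue_on \<Omega>)"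
    and "AE x in lebesgue_on \<Omega>. f x = g x"
  shows "l2norm \<Omega> f = l2norm \<Omega> g"
proof -
  have "(\<integral>x. (norm (f x))\<^sup>2 \<partial>lebesgue_on \<Omega>) = (\<integral>x. (norm (g x))\<^sup>2 \<partial>lebesgue_on \<Omega>)"
    using assms by (intro integral_cong_AE) auto
  then show ?thesis by (simp add: l2norm_def)
qed

lemma H10_L2: "H10 \<Omega> w \<Longrightarrow> L2 \<Omega> w"
  by (simp add: H10_def)

text \<open>The gradient inside \<open>H10\<close> is existentially bound. It agrees a.e. with the
  given \<open>g\<close>, so the approximating sequence serves for \<open>g\<close> as well.\<close>

lemma H10_test_fn_sequence:
  assumes \<Omega>: "open \<Omega>" and w: "H10 \<Omega> w" "L2 \<Omega> g" "weak_grad \<Omega> w g"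
  obtains \<phi> where "\<And>k. test_fn \<Omega> (\<phi> k)"
    "(\<lambda>k. l2norm \<Omega> (\<lambda>x. \<phi> k x - w x)) \<longlonglongrightarrow> 0"
    "(\<lambda>k. l2norm \<Omega> (\<lambda>x. cgrad (\<phi> k) x - g x)) \<longlonglongrightarrow> 0"
proof -
  obtain h \<phi> where h: "L2 \<Omega> h" "weak_grad \<Omega> w h" and \<phi>: "\<And>k. test_fn \<Omega> (\<phi> k)" and
    lim: "(\<lambda>k. l2norm \<Omega> (\<lambda>x. \<phi> k x - w x) + l2norm \<Omega> (\<lambda>x. cgrad (\<phi> k) x - h x)) \<longlonglongrightarrow> 0"
    using w(1) unfolding H10_def by blast
  have eq: "l2norm \<Omega> (\<lambda>x. cgrad (\<phi> k) x - h x) = l2norm \<Omega> (\<lambda>x. cgrad (\<phi> k) x - g x)" for k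
    using L2_diff[OF cgrad_L2[OF \<phi> \<Omega>] h(1), of k] L2_diff[OF cgrad_L2[OF \<phi> \<Omega>] w(2), of k]
      weak_grad_unique[OF \<Omega> h w(2,3)]
    by (intro l2norm_cong_AE) (auto dest: L2_measurable elim: eventually_mono)
  show ?thesis
  proof
    show "(\<lambda>k. l2norm \<Omega> (\<lambda>x. \<phi> k x - w x)) \<longlonglongrightarrow> 0"
      by (rule Lim_null_comparison[OF always_eventually lim]) simp
    show "(\<lambda>k. l2norm \<Omega> (\<lambda>x. cgrad (\<phi> k) x - g x)) \<longlonglongrightarrow> 0"
      using lim unfolding eq by (rule Lim_null_comparison[OF always_eventually, rotated]) simp
  qed fact
qed

text \<open>The distributional definition pairs bilinearly. Testing with the conjugate of \<phi>
  makes the pairing sesquilinear, and its real part is the real inner product.\<close>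

lemma weak_div_test_fn:
  assumes \<Omega>: "open \<Omega>" and q: "L2 \<Omega> q" "L2 \<Omega> d" "weak_div \<Omega> q d" and \<phi>: "test_fn \<Omega> \<phi>"
  shows "(\<integral>x. cgrad \<phi> x \<bullet> q x \<partial>lebesgue_on \<Omega>) = - (\<integral>x. \<phi> x \<bullet> d x \<partial>lebesgue_on \<Omega>)"
proof -
  have pd: "(\<Sum>i\<in>UNIV. q x $ i * pd i (\<lambda>x. cnj (\<phi> x)) x) = cdot (q x) (cgrad \<phi> x)" for x
    by (simp add: cdot_def cgrad_def pd_cnj[OF \<phi>])
  have 1: "integrable (lebesgue_on \<Omega>) (\<lambda>x. cdot (q x) (cgrad \<phi> x))"
    unfolding cdot_def by (intro Bochner_Integration.integrable_sum L2_mult_integrable L2_nth L2_cnj cgrad_L2 q \<phi> \<Omega>)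
  have 2: "integrable (lebesgue_on \<Omega>) (\<lambda>x. d x * cnj (\<phi> x))"
    by (intro L2_mult_integrable L2_cnj test_fn_L2 q \<phi> \<Omega>)
  have "(\<integral>x. cdot (q x) (cgrad \<phi> x) \<partial>lebesgue_on \<Omega>) = - (\<integral>x. d x * cnj (\<phi> x) \<partial>lebesgue_on \<Omega>)"
    using q(3) test_fn_cnj[OF \<phi>] unfolding weak_div_def pd[symmetric] by blast
  then have "Re (\<integral>x. cdot (q x) (cgrad \<phi> x) \<partial>lebesgue_on \<Omega>) = - Re (\<integral>x. d x * cnj (\<phi> x) \<partial>lebesgue_on \<Omega>)"
    by simp
  then show ?thesis
    using 1 2 by (simp only: integral_Re[symmetric] Re_cdot Re_mult_cnj inner_commute)
qed

lemma H10_Green: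
  assumes \<Omega>: "open \<Omega>" and w: "H10 \<Omega> w" "L2 \<Omega> g" "weak_grad \<Omega> w g"
    and q: "L2 \<Omega> q" "L2 \<Omega> d" "weak_div \<Omega> q d"
  shows "(\<integral>x. g x \<bullet> q x \<partial>lebesgue_on \<Omega>) = - (\<integral>x. w x \<bullet> d x \<partial>lebesgue_on \<Omega>)"
proof -
  obtain \<phi> where \<phi>: "\<And>k. test_fn \<Omega> (\<phi> k)"
    "(\<lambda>k. l2norm \<Omega> (\<lambda>x. \<phi> k x - w x)) \<longlonglongrightarrow> 0"
    "(\<lambda>k. l2norm \<Omega> (\<lambda>x. cgrad (\<phi> k) x - g x)) \<longlonglongrightarrow> 0"
    using H10_test_fn_sequence[OF \<Omega> w] by blast
  have const: "(\<lambda>k. l2norm \<Omega> (\<lambda>x. h x - h x)) \<longlonglongrightarrow> 0" for h :: "real^'a \<Rightarrow> 'c::euclidean_space"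
    by (simp add: l2norm_def)
  have "(\<lambda>k. \<integral>x. cgrad (\<phi> k) x \<bullet> q x \<partial>lebesgue_on \<Omega>) \<longlonglongrightarrow> (\<integral>x. g x \<bullet> q x \<partial>lebesgue_on \<Omega>)"
    by (rule l2norm_tendsto_inner[OF _ _ _ _ \<phi>(3) const]) (use w q cgrad_L2[OF \<phi>(1) \<Omega>] in auto)
  moreover have "(\<lambda>k. - (\<integral>x. \<phi> k x \<bullet> d x \<partial>lebesgue_on \<Omega>)) \<longlonglongrightarrow> - (\<integral>x. w x \<bullet> d x \<partial>lebesgue_on \<Omega>)"
    by (intro tendsto_minus l2norm_tendsto_inner[OF _ _ _ _ \<phi>(2) const])
      (use w q test_fn_L2[OF \<phi>(1) \<Omega>] in \<open>auto simp: H10_L2\<close>)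
  ultimately show ?thesis
    unfolding weak_div_test_fn[OF \<Omega> q \<phi>(1)] by (rule LIMSEQ_unique)
qed

section \<open>Bounded coefficients and the convection identity\<close>

lemma L2_Linf_scaleR:
  assumes "Linf \<Omega> d"
  obtains C where "\<And>g :: real^'n::finite \<Rightarrow> 'b::euclidean_space. L2 \<Omega> g \<Longrightarrow> L2 \<Omega> (\<lambda>x. d x *\<^sub>R g x)"
    "\<And>g :: real^'n \<Rightarrow> 'b. L2 \<Omega> g \<Longrightarrow> l2norm \<Omega> (\<lambda>x. d x *\<^sub>R g x) \<le> C * l2norm \<Omega> g"
proof -
  obtain M where M: "AE x in lebesgue_on \<Omega>. norm (d x) \<le> M" and m: "d \<in> borel_measurable (lebesgue_on \<Omega>)"
    using assms by (auto simp: Linf_def)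
  \<comment> \<open>An essential bound \<open>M\<close> may be negative on a null domain, while
    domination asks for a nonnegative factor. The factor does not depend on \<open>g\<close>, so it
    survives passage to the limit.\<close>
  have le: "AE x in lebesgue_on \<Omega>. norm (d x *\<^sub>R g x) \<le> max M 0 * norm (g x)" for g :: "real^'n \<Rightarrow> 'b"
    using M by eventually_elim (auto intro!: mult_right_mono)
  have meas: "L2 \<Omega> g \<Longrightarrow> (\<lambda>x. d x *\<^sub>R g x) \<in> borel_measurable (lebesgue_on \<Omega>)" for g :: "real^'n \<Rightarrow> 'b"
    using m by (auto simp: L2_def)
  show ?thesis
    by (rule that) (rule L2_dominated_L2[OF _ meas _ le] L2_dominated_norm[OF _ meas _ le]; simp)+
qed

lemma norm_bdot_le: "norm (bdot (b :: real^'n::finite) g) \<le> real CARD('n) * norm b * norm g"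
proof -
  have "norm (bdot b g) \<le> (\<Sum>i\<in>(UNIV::'n set). norm b * norm g)"
    unfolding bdot_def
    by (rule sum_norm_le) (auto simp: norm_mult intro!: mult_mono component_le_norm_cart Finite_Cartesian_Product.norm_nth_le)
  then show ?thesis by simp
qed

lemma L2_Linf_bdot:
  fixes b :: "real^'n::finite \<Rightarrow> real^'n"
  assumes "Linf \<Omega> b"
  obtains C where "\<And>g. L2 \<Omega> g \<Longrightarrow> L2 \<Omega> (\<lambda>x. bdot (b x) (g x))"
    "\<And>g. L2 \<Omega> g \<Longrightarrow> l2norm \<Omega> (\<lambda>x. bdot (b x) (g x)) \<le> C * l2norm \<Omega> g"
proof -
  obtain M where M: "AE x in lebesgue_on \<Omega>. norm (b x) \<le> M" and m: "b \<in> borel_measurable (lebesgue_on \<Omega>)"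
    using assms by (auto simp: Linf_def)
  have le: "AE x in lebesgue_on \<Omega>. norm (bdot (b x) (g x)) \<le> (real CARD('n) * max M 0) * norm (g x)" for g
    using M
  proof eventually_elim
    case (elim x)
    have "real CARD('n) * norm (b x) * norm (g x) \<le> (real CARD('n) * max M 0) * norm (g x)"
      using elim by (intro mult_right_mono mult_left_mono) auto
    then show ?case using norm_bdot_le[of "b x" "g x"] by linarith
  qed
  have meas: "L2 \<Omega> g \<Longrightarrow> (\<lambda>x. bdot (b x) (g x)) \<in> borel_measurable (lebesgue_on \<Omega>)" for g
    unfolding bdot_def L2_def using m
    by (auto intro!: borel_measurable_sum borel_measurable_times borel_measurable_of_real borel_measurable_vec_nth)
  show ?thesis
    by (rule that) (rule L2_dominated_L2[OF _ meas _ le] L2_dominated_norm[OF _ meas _ le]; simp)+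
qed

lemma bdot_diff: "bdot b (g - h) = bdot b g - bdot b h"
  by (simp add: bdot_def sum_subtractf algebra_simps)

lemma bdot_inner: "bdot b g \<bullet> z = (\<Sum>i\<in>UNIV. b $ i * (g $ i \<bullet> z))"
  unfolding bdot_def inner_sum_left by (rule sum.cong) (simp_all add: inner_complex_def algebra_simps)

text \<open>The test function for div b is |\<phi>|^2, written as \<phi> times its conjugate. Its
  i-th partial derivative is twice the real inner product of the i-th derivative of \<phi> with
  \<phi>; as b is real, summation gives the convection term.\<close>

lemma convection_test_fn:
  assumes b: "weak_div \<Omega> (\<lambda>x. cvec (b x)) (\<lambda>x. complex_of_real (d x))" and \<phi>: "test_fn \<Omega> \<phi>"
  shows "2 * (\<integral>x. bdot (b x) (cgrad \<phi> x) \<bullet> \<phi> x \<partial>lebesgue_on \<Omega>) = - (\<integral>x. (d x *\<^sub>R \<phi> x) \<bullet> \<phi> x \<partial>lebesgue_on \<Omega>)"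
proof -
  let ?\<psi> = "\<lambda>x. \<phi> x * cnj (\<phi> x)"
  have *: "z * cnj w + w * cnj z = complex_of_real (2 * (w \<bullet> z))" for z w
    by (simp add: complex_eq_iff inner_complex_def algebra_simps)
  have pd: "pd i ?\<psi> x = complex_of_real (2 * (pd i \<phi> x \<bullet> \<phi> x))" for i x
    unfolding pd_mult[OF \<phi> test_fn_cnj[OF \<phi>]] pd_cnj[OF \<phi>] by (rule *)
  have "(\<Sum>i\<in>UNIV. cvec (b x) $ i * pd i ?\<psi> x) = complex_of_real (2 * (bdot (b x) (cgrad \<phi> x) \<bullet> \<phi> x))" for x
    by (simp add: pd cvec_def bdot_inner cgrad_def sum_distrib_left mult_ac)
  moreover have "complex_of_real (d x) * ?\<psi> x = complex_of_real ((d x *\<^sub>R \<phi> x) \<bullet> \<phi> x)" for x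
    by (simp add: complex_eq_iff inner_complex_def algebra_simps)
  moreover have "(\<integral>x. (\<Sum>i\<in>UNIV. cvec (b x) $ i * pd i ?\<psi> x) \<partial>lebesgue_on \<Omega>)
      = - (\<integral>x. complex_of_real (d x) * ?\<psi> x \<partial>lebesgue_on \<Omega>)"
    using b test_fn_mult[OF \<phi> test_fn_cnj[OF \<phi>]] unfolding weak_div_def by blast
  ultimately have "complex_of_real (\<integral>x. 2 * (bdot (b x) (cgrad \<phi> x) \<bullet> \<phi> x) \<partial>lebesgue_on \<Omega>)
      = complex_of_real (- (\<integral>x. (d x *\<^sub>R \<phi> x) \<bullet> \<phi> x \<partial>lebesgue_on \<Omega>))"
    by (simp only: integral_complex_of_real of_real_minus)
  then show ?thesis
    by (simp only: of_real_eq_iff integral_mult_right_zero)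
qed

lemma H10_convection:
  assumes \<Omega>: "open \<Omega>" and w: "H10 \<Omega> w" "L2 \<Omega> g" "weak_grad \<Omega> w g"
    and b: "Linf \<Omega> b" "Linf \<Omega> d" "weak_div \<Omega> (\<lambda>x. cvec (b x)) (\<lambda>x. complex_of_real (d x))"
  shows "2 * (\<integral>x. bdot (b x) (g x) \<bullet> w x \<partial>lebesgue_on \<Omega>) = - (\<integral>x. (d x *\<^sub>R w x) \<bullet> w x \<partial>lebesgue_on \<Omega>)"
proof -
  obtain \<phi> where \<phi>: "\<And>k. test_fn \<Omega> (\<phi> k)"
    "(\<lambda>k. l2norm \<Omega> (\<lambda>x. \<phi> k x - w x)) \<longlonglongrightarrow> 0"
    "(\<lambda>k. l2norm \<Omega> (\<lambda>x. cgrad (\<phi> k) x - g x)) \<longlonglongrightarrow> 0"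
    using H10_test_fn_sequence[OF \<Omega> w] by blast
  note L2s = test_fn_L2[OF \<phi>(1) \<Omega>] cgrad_L2[OF \<phi>(1) \<Omega>] H10_L2[OF w(1)] w(2)
  obtain B where B: "\<And>g. L2 \<Omega> g \<Longrightarrow> L2 \<Omega> (\<lambda>x. bdot (b x) (g x))"
    "\<And>g. L2 \<Omega> g \<Longrightarrow> l2norm \<Omega> (\<lambda>x. bdot (b x) (g x)) \<le> B * l2norm \<Omega> g"
    using L2_Linf_bdot[OF b(1)] by metis
  obtain D where D: "\<And>g :: real^'a \<Rightarrow> complex. L2 \<Omega> g \<Longrightarrow> L2 \<Omega> (\<lambda>x. d x *\<^sub>R g x)"
    "\<And>g :: real^'a \<Rightarrow> complex. L2 \<Omega> g \<Longrightarrow> l2norm \<Omega> (\<lambda>x. d x *\<^sub>R g x) \<le> D * l2norm \<Omega> g"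
    using L2_Linf_scaleR[OF b(2)] by metis
  have 1: "(\<lambda>k. l2norm \<Omega> (\<lambda>x. bdot (b x) (cgrad (\<phi> k) x) - bdot (b x) (g x))) \<longlonglongrightarrow> 0"
  proof (rule Lim_null_comparison[OF always_eventually])
    show "\<forall>k. norm (l2norm \<Omega> (\<lambda>x. bdot (b x) (cgrad (\<phi> k) x) - bdot (b x) (g x)))
        \<le> B * l2norm \<Omega> (\<lambda>x. cgrad (\<phi> k) x - g x)"
      using B(2)[OF L2_diff[OF L2s(2,4)]] by (simp add: bdot_diff)
    show "(\<lambda>k. B * l2norm \<Omega> (\<lambda>x. cgrad (\<phi> k) x - g x)) \<longlonglongrightarrow> 0"
      using tendsto_mult_left[OF \<phi>(3), of B] by simp
  qed
  have 2: "(\<lambda>k. l2norm \<Omega> (\<lambda>x. d x *\<^sub>R \<phi> k x - d x *\<^sub>R w x)) \<longlonglongrightarrow> 0"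
  proof (rule Lim_null_comparison[OF always_eventually])
    show "\<forall>k. norm (l2norm \<Omega> (\<lambda>x. d x *\<^sub>R \<phi> k x - d x *\<^sub>R w x)) \<le> D * l2norm \<Omega> (\<lambda>x. \<phi> k x - w x)"
      using D(2)[OF L2_diff[OF L2s(1,3)]] by (simp add: scaleR_diff_right)
    show "(\<lambda>k. D * l2norm \<Omega> (\<lambda>x. \<phi> k x - w x)) \<longlonglongrightarrow> 0"
      using tendsto_mult_left[OF \<phi>(2), of D] by simp
  qed
  have "(\<lambda>k. 2 * (\<integral>x. bdot (b x) (cgrad (\<phi> k) x) \<bullet> \<phi> k x \<partial>lebesgue_on \<Omega>)) \<longlonglongrightarrow>
      2 * (\<integral>x. bdot (b x) (g x) \<bullet> w x \<partial>lebesgue_on \<Omega>)"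
    by (intro tendsto_mult_left l2norm_tendsto_inner[OF _ _ _ _ 1 \<phi>(2)] B(1) L2s)
  moreover have "(\<lambda>k. - (\<integral>x. (d x *\<^sub>R \<phi> k x) \<bullet> \<phi> k x \<partial>lebesgue_on \<Omega>)) \<longlonglongrightarrow>
      - (\<integral>x. (d x *\<^sub>R w x) \<bullet> w x \<partial>lebesgue_on \<Omega>)"
    by (intro tendsto_minus l2norm_tendsto_inner[OF _ _ _ _ 2 \<phi>(2)] D(1) L2s)
  ultimately show ?thesis
    unfolding convection_test_fn[OF b(3) \<phi>(1)] by (rule LIMSEQ_unique)
qed

section \<open>Elliptic coefficients\<close>

lemma norm_matrix_vector_mult_le:
  fixes A :: "complex^'n^'m"
  shows "norm (A *v v) \<le> real CARD('m) * real CARD('n) * norm A * norm v"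
proof -
  have "norm (A *v v) \<le> (\<Sum>i\<in>UNIV. norm ((A *v v) $ i))"
    unfolding norm_vec_def by (rule L2_set_le_sum) simp
  also have "\<dots> \<le> (\<Sum>i\<in>(UNIV::'m set). \<Sum>j\<in>(UNIV::'n set). norm A * norm v)"
  proof (rule sum_mono)
    fix i :: 'm
    have "norm (A $ i $ j * v $ j) \<le> norm A * norm v" for j
      unfolding norm_mult
      by (intro mult_mono Finite_Cartesian_Product.norm_nth_le norm_ge_zero
          order.trans[OF Finite_Cartesian_Product.norm_nth_le Finite_Cartesian_Product.norm_nth_le])
    then have "norm (\<Sum>j\<in>UNIV. A $ i $ j * v $ j) \<le> (\<Sum>j\<in>(UNIV::'n set). norm A * norm v)"
      by (intro sum_norm_le)
    then show "norm ((A *v v) $ i) \<le> (\<Sum>j\<in>(UNIV::'n set). norm A * norm v)"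
      by (simp only: matrix_vector_mult_def vec_lambda_beta)
  qed
  also have "\<dots> = real CARD('m) * real CARD('n) * norm A * norm v" by simp
  finally show ?thesis .
qed

lemma borel_measurable_matrix_vector_mult [measurable (raw)]:
  fixes A :: "'a \<Rightarrow> complex^'n^'m"
  assumes "A \<in> borel_measurable M" "v \<in> borel_measurable M"
  shows "(\<lambda>x. A x *v v x) \<in> borel_measurable M"
  unfolding matrix_vector_mult_def using assms
  by (intro borel_measurable_vec_lambda borel_measurable_sum borel_measurable_times borel_measurable_vec_nth)

lemma borel_measurable_det:
  fixes A :: "'a \<Rightarrow> complex^'n^'n"
  assumes "\<And>i j. (\<lambda>x. A x $ i $ j) \<in> borel_measurable M"
  shows "(\<lambda>x. det (A x)) \<in> borel_measurable M"
  unfolding det_def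
  by (intro borel_measurable_sum borel_measurable_times borel_measurable_prod borel_measurable_const assms)

lemma invertible_matrix_inv:
  assumes "invertible A"
  shows "matrix_inv A ** A = mat 1" "A ** matrix_inv A = mat 1"
  using someI_ex[OF assms[unfolded invertible_def]] unfolding matrix_inv_def by blast+

text \<open>On singular matrices \<^const>\<open>matrix_inv\<close> is a fixed junk value, so it is measurable everywhere.\<close>
lemma borel_measurable_matrix_inv:
  fixes A :: "'a \<Rightarrow> complex^'n^'n"
  assumes A: "A \<in> borel_measurable M" and q: "q \<in> borel_measurable M"
  shows "(\<lambda>x. matrix_inv (A x) *v q x) \<in> borel_measurable M"
proof -
  \<comment> \<open>The choice operator sees only its predicate, and for every singular matrix this
    predicate is the constant \<open>False\<close>; hence all of them share the value
    \<open>K\<close>.\<close>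
  define K :: "complex^'n^'n" where "K = (SOME B. False)"
  \<comment> \<open>Cramer's rule: on regular matrices the components are quotients of determinants,
    which are polynomials in measurable entries.\<close>
  define C where "C = (\<lambda>x. \<chi> k. det (\<chi> i j. if j = k then q x $ i else A x $ i $ j) / det (A x))"
  have eq: "matrix_inv (A x) *v q x = (if det (A x) = 0 then K *v q x else C x)" for x
  proof (cases "det (A x) = 0")
    case True
    then have "(\<lambda>B. A x ** B = mat 1 \<and> B ** A x = mat 1) = (\<lambda>B. False)"
      using invertible_det_nz[of "A x"] by (auto simp: invertible_def)
    then have "matrix_inv (A x) = K" by (simp only: matrix_inv_def K_def)
    then show ?thesis using True by simp
  next
    case False
    then have "A x *v (matrix_inv (A x) *v q x) = q x"
      using invertible_det_nz[of "A x"] by (simp add: invertible_matrix_inv matrix_vector_mul_assoc)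
    then show ?thesis using cramer[OF False] False by (simp add: C_def)
  qed
  have [measurable]: "(\<lambda>x. A x $ i $ j) \<in> borel_measurable M" "(\<lambda>x. q x $ i) \<in> borel_measurable M" for i j
    using A q by (intro borel_measurable_vec_nth; simp)+
  have [measurable]: "(\<lambda>x. det (A x)) \<in> borel_measurable M"
    by (rule borel_measurable_det) simp
  have "C \<in> borel_measurable M"
    unfolding C_def
  proof (intro borel_measurable_vec_lambda borel_measurable_divide borel_measurable_det)
    show "(\<lambda>x. (\<chi> i j. if j = k then q x $ i else A x $ i $ j) $ i $ j) \<in> borel_measurable M" for k i j
      by (cases "j = k") simp_all
  qed simp
  moreover have "(\<lambda>x. K *v q x) \<in> borel_measurable M" using q by simp
  moreover have "{x \<in> space M. det (A x) = 0} \<in> sets M" by measurable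
  ultimately show ?thesis unfolding eq by (intro measurable_If)
qed

lemma L2_matrix_vector_mult:
  fixes A :: "real^'n::finite \<Rightarrow> complex^'n^'n"
  assumes A: "Linf \<Omega> A" and v: "L2 \<Omega> v"
  shows "L2 \<Omega> (\<lambda>x. A x *v v x)"
proof -
  obtain M where M: "AE x in lebesgue_on \<Omega>. norm (A x) \<le> M" and m: "A \<in> borel_measurable (lebesgue_on \<Omega>)"
    using A by (auto simp: Linf_def)
  let ?C = "real CARD('n) * real CARD('n)"
  have "AE x in lebesgue_on \<Omega>. norm (A x *v v x) \<le> (?C * max M 0) * norm (v x)"
    using M
  proof eventually_elim
    case (elim x)
    have "?C * norm (A x) * norm (v x) \<le> (?C * max M 0) * norm (v x)"
      using elim by (intro mult_right_mono mult_left_mono) auto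
    then show ?case using norm_matrix_vector_mult_le[of "A x" "v x"] by linarith
  qed
  then show ?thesis
    using m L2_measurable[OF v] by (intro L2_dominated_L2[OF v]) auto
qed

lemma L2_indicator_const:
  assumes "S \<in> lmeasurable" "S \<subseteq> \<Omega>" "\<Omega> \<in> sets lebesgue"
  shows "L2 \<Omega> (\<lambda>x. indicator S x *\<^sub>R (v :: 'b::euclidean_space))"
proof -
  note i = integrable_indicator_lebesgue_on[OF assms]
  have "(norm (indicator S x *\<^sub>R v))\<^sup>2 = indicator S x * (norm v)\<^sup>2" for x
    by (simp add: indicator_def)
  then show ?thesis
    using i borel_measurable_integrable[OF i] by (simp add: L2_def)
qed

text \<open>Test with \<open>v\<close> times the indicator of a bounded part of the set where the pointwise bound fails;
  a countable dense set of \<open>v\<close> makes the exceptional null set independent of \<open>v\<close>.\<close>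
lemma elliptic_AE:
  fixes A :: "real^'n::finite \<Rightarrow> complex^'n^'n"
  assumes \<Omega>: "open \<Omega>" and A: "Linf \<Omega> A"
    and ell: "\<And>\<phi>. L2 \<Omega> \<phi> \<Longrightarrow> \<alpha> * (l2norm \<Omega> \<phi>)\<^sup>2 \<le> mnorm2 \<Omega> A \<phi>"
  shows "AE x in lebesgue_on \<Omega>. \<forall>v. \<alpha> * (norm v)\<^sup>2 \<le> (A x *v v) \<bullet> v"
proof -
  have \<Omega>': "\<Omega> \<in> sets lebesgue" using \<Omega> by auto
  have m [measurable]: "A \<in> borel_measurable (lebesgue_on \<Omega>)" using A by (simp add: Linf_def)
  define h where "h v x = (A x *v v) \<bullet> v - \<alpha> * (norm v)\<^sup>2" for v x
  have h_meas [measurable]: "h v \<in> borel_measurable (lebesgue_on \<Omega>)" for v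
    unfolding h_def[abs_def] by measurable
  have *: "AE x in lebesgue_on \<Omega>. 0 \<le> h v x" for v
  proof -
    have "AE x in lebesgue_on \<Omega>. x \<in> ball 0 (real R) \<longrightarrow> 0 \<le> h v x" for R
    proof -
      define S where "S = {x \<in> space (lebesgue_on \<Omega>). h v x < 0} \<inter> ball 0 (real R)"
      have S: "S \<in> lmeasurable" "S \<subseteq> \<Omega>"
      proof -
        have "{x \<in> space (lebesgue_on \<Omega>). h v x < 0} \<in> sets (lebesgue_on \<Omega>)" by measurable
        then have "{x \<in> space (lebesgue_on \<Omega>). h v x < 0} \<in> sets lebesgue"
          using \<Omega>' by (auto simp: sets_restrict_space_iff)
        then show "S \<in> lmeasurable" unfolding S_def
          by (intro fmeasurable_Int_fmeasurable[of "ball 0 (real R)", unfolded Int_commute[of "ball _ _"]]) auto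
      qed (auto simp: S_def)
      define \<phi> where "\<phi> x = indicator S x *\<^sub>R v" for x
      have \<phi>: "L2 \<Omega> \<phi>" unfolding \<phi>_def by (rule L2_indicator_const[OF S \<Omega>'])
      note A\<phi> = L2_inner[OF L2_matrix_vector_mult[OF A \<phi>] \<phi>]
      \<comment> \<open>By the choice of \<open>S\<close> this function is nonnegative and strictly
        positive on \<open>S\<close>; by the integrated ellipticity at \<phi> its integral is at
        most 0. So it vanishes a.e. and \<open>S\<close> is null.\<close>
      let ?k = "\<lambda>x. \<alpha> * (norm (\<phi> x))\<^sup>2 - (A x *v \<phi> x) \<bullet> \<phi> x"
      have k_int: "integrable (lebesgue_on \<Omega>) ?k"
        using A\<phi> L2_integrable[OF \<phi>] by auto
      have k_eq: "?k x = indicator S x * - h v x" for x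
        by (cases "x \<in> S") (auto simp: \<phi>_def h_def)
      have k_nonneg: "0 \<le> ?k x" for x
        unfolding k_eq by (auto simp: indicator_def S_def)
      have "(\<integral>x. ?k x \<partial>lebesgue_on \<Omega>) = \<alpha> * (l2norm \<Omega> \<phi>)\<^sup>2 - mnorm2 \<Omega> A \<phi>"
        using A\<phi> L2_integrable[OF \<phi>] by (simp add: mnorm2_def Re_cdot l2norm_squared)
      then have "(\<integral>x. ?k x \<partial>lebesgue_on \<Omega>) = 0"
        using ell[OF \<phi>] k_nonneg by (intro antisym integral_nonneg_AE) auto
      then have "AE x in lebesgue_on \<Omega>. ?k x = 0"
        using integral_nonneg_eq_0_iff_AE[OF k_int] k_nonneg by auto
      moreover have "AE x in lebesgue_on \<Omega>. x \<in> \<Omega>" by (rule AE_I2) simp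
      ultimately show ?thesis
        unfolding k_eq by eventually_elim (auto simp: S_def indicator_def split: if_splits)
    qed
    then have "AE x in lebesgue_on \<Omega>. \<forall>R. x \<in> ball 0 (real R) \<longrightarrow> 0 \<le> h v x"
      unfolding AE_all_countable by blast
    then show ?thesis
    proof eventually_elim
      case (elim x)
      obtain R where "norm x < real R" using reals_Archimedean2 by blast
      then show ?case using elim by (auto simp: dist_norm)
    qed
  qed
  obtain D :: "(complex^'n) set" where D: "countable D" "\<And>X. open X \<Longrightarrow> X \<noteq> {} \<Longrightarrow> \<exists>d\<in>D. d \<in> X"
    using countable_dense_exists by blast
  have "AE x in lebesgue_on \<Omega>. \<forall>v\<in>D. 0 \<le> h v x"
    using * by (simp add: AE_ball_countable[OF D(1)])
  then show ?thesis
  proof eventually_elim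
    case (elim x)
    have "continuous_on UNIV (\<lambda>v. h v x)"
      unfolding h_def matrix_vector_mult_def by (intro continuous_intros)
    \<comment> \<open>Continuity in v turns a violation at one vector into a violation on a nonempty
      open set, which must meet \<open>D\<close>.\<close>
    then have "open {v. h v x < 0}"
      by (intro open_Collect_less) (auto intro: continuous_intros)
    have "0 \<le> h v x" for v
    proof (rule ccontr)
      assume "\<not> 0 \<le> h v x"
      then have "{v. h v x < 0} \<noteq> {}" by (auto simp: not_le)
      then obtain d where "d \<in> D" "h d x < 0"
        using D(2)[OF \<open>open {v. h v x < 0}\<close>] by blast
      then show False using elim by (simp add: not_less[symmetric])
    qed
    then show ?case by (simp add: h_def)
  qed
qed

section \<open>Pointwise algebra of elliptic Hermitian matrices\<close>

context
  fixes A :: "complex^'n^'n" and \<alpha> :: real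
  assumes pos: "0 < \<alpha>" and ell: "\<And>v. \<alpha> * (norm v)\<^sup>2 \<le> (A *v v) \<bullet> v"
begin

lemma elliptic_invertible: "invertible A"
proof -
  have "v = 0" if "A *v v = 0" for v
  proof -
    have "\<alpha> * (norm v)\<^sup>2 \<le> 0" using ell[of v] that by simp
    then have "(norm v)\<^sup>2 \<le> 0" using pos by (simp only: mult_le_0_iff) auto
    then show ?thesis by simp
  qed
  then show ?thesis
    by (simp add: invertible_left_inverse matrix_left_invertible_ker)
qed

lemma elliptic_matrix_inv: "A *v (matrix_inv A *v q) = q" "matrix_inv A *v (A *v q) = q"
  by (simp_all add: invertible_matrix_inv[OF elliptic_invertible] matrix_vector_mul_assoc)

text \<open>At y = A^{-1} q ellipticity reads \<alpha> |y|^2 \<le> q \<bullet> y, and Cauchy-Schwarz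
  finishes. The bound makes A^{-1} q square integrable whenever q is.\<close>

lemma elliptic_norm_matrix_inv: "norm (matrix_inv A *v q) \<le> 1 / \<alpha> * norm q"
proof -
  let ?y = "matrix_inv A *v q"
  have "\<alpha> * norm ?y * norm ?y \<le> norm q * norm ?y"
    using ell[of ?y] norm_cauchy_schwarz[of q ?y]
    by (simp add: elliptic_matrix_inv power2_eq_square mult.assoc)
  then have "\<alpha> * norm ?y \<le> norm q" by (cases "?y = 0") (auto simp: mult_le_cancel_right)
  then show ?thesis using pos by (simp add: field_simps)
qed

end

lemma L2_matrix_inv:
  fixes A :: "real^'n::finite \<Rightarrow> complex^'n^'n"
  assumes "0 < \<alpha>" "A \<in> borel_measurable (lebesgue_on \<Omega>)" "L2 \<Omega> q"
    and "AE x in lebesgue_on \<Omega>. \<forall>v. \<alpha> * (norm v)\<^sup>2 \<le> (A x *v v) \<bullet> v"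
  shows "L2 \<Omega> (\<lambda>x. matrix_inv (A x) *v q x)"
proof (rule L2_dominated_L2[OF assms(3)])
  show "AE x in lebesgue_on \<Omega>. norm (matrix_inv (A x) *v q x) \<le> 1 / \<alpha> * norm (q x)"
    using assms(4) by eventually_elim (rule elliptic_norm_matrix_inv[OF assms(1)], blast)
  show "(\<lambda>x. matrix_inv (A x) *v q x) \<in> borel_measurable (lebesgue_on \<Omega>)"
    by (rule borel_measurable_matrix_inv[OF assms(2) L2_measurable[OF assms(3)]])
qed (use assms(1) in simp)

lemma hermitian_inner:
  fixes A :: "complex^'n^'n"
  assumes "\<And>i j. A $ i $ j = cnj (A $ j $ i)"
  shows "(A *v v) \<bullet> w = v \<bullet> (A *v w)"
proof -
  have "cdot (A *v v) w = (\<Sum>i\<in>UNIV. \<Sum>j\<in>UNIV. A $ i $ j * v $ j * cnj (w $ i))"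
    by (simp add: cdot_def matrix_vector_mult_def sum_distrib_right)
  also have "\<dots> = (\<Sum>j\<in>UNIV. \<Sum>i\<in>UNIV. A $ i $ j * v $ j * cnj (w $ i))"
    by (rule sum.swap)
  also have "\<dots> = (\<Sum>j\<in>UNIV. \<Sum>i\<in>UNIV. v $ j * cnj (A $ j $ i * w $ i))"
    by (intro sum.cong refl) (simp add: assms[symmetric] mult_ac)
  also have "\<dots> = cdot v (A *v w)"
    by (simp add: cdot_def matrix_vector_mult_def sum_distrib_left)
  finally show ?thesis by (simp only: Re_cdot[symmetric])
qed

text \<open>Since A is Hermitian, A^{-1} q paired with A g is q paired with g. The mixed term is
  therefore free of A and is the one that Green's formula evaluates.\<close>

lemma elliptic_dual_expand:
  fixes A :: "complex^'n^'n"
  assumes "\<And>i j. A $ i $ j = cnj (A $ j $ i)" "0 < \<alpha>" "\<And>v. \<alpha> * (norm v)\<^sup>2 \<le> (A *v v) \<bullet> v"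
  shows "(matrix_inv A *v (A *v g - q)) \<bullet> (A *v g - q)
    = (A *v g) \<bullet> g + (matrix_inv A *v q) \<bullet> q - 2 * (g \<bullet> q)"
proof -
  note inv = elliptic_matrix_inv[OF assms(2,3)] and herm = hermitian_inner[OF assms(1)]
  have "(matrix_inv A *v q) \<bullet> (A *v g) = g \<bullet> q"
    using herm[of "matrix_inv A *v q" g] by (simp add: inv inner_commute)
  then show ?thesis
    by (simp add: matrix_vector_mult_diff_distrib inv inner_simps inner_commute)
qed

text \<open>The right-hand side is the quadratic form of A at g + A^{-1} q. Together with the
  expansion above it bounds the dual residual by twice the sum of the two energies, which is the
  source of the factor 1/2 in the lower bounds.\<close>

lemma elliptic_dual_Young:
  fixes A :: "complex^'n^'n"
  assumes "\<And>i j. A $ i $ j = cnj (A $ j $ i)" "0 < \<alpha>" "\<And>v. \<alpha> * (norm v)\<^sup>2 \<le> (A *v v) \<bullet> v"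
  shows "0 \<le> (A *v g) \<bullet> g + (matrix_inv A *v q) \<bullet> q + 2 * (g \<bullet> q)"
proof -
  let ?y = "matrix_inv A *v q"
  have "(A *v (g + ?y)) \<bullet> (g + ?y) = (A *v g) \<bullet> g + ?y \<bullet> q + (g \<bullet> q + (A *v g) \<bullet> ?y)"
    by (simp add: matrix_vector_right_distrib elliptic_matrix_inv[OF assms(2,3)] inner_simps inner_commute)
  also have "(A *v g) \<bullet> ?y = g \<bullet> q"
    by (simp add: hermitian_inner[OF assms(1)] elliptic_matrix_inv[OF assms(2,3)])
  finally have "(A *v (g + ?y)) \<bullet> (g + ?y) = (A *v g) \<bullet> g + ?y \<bullet> q + 2 * (g \<bullet> q)" by simp
  moreover have "0 \<le> \<alpha> * (norm (g + ?y))\<^sup>2" using assms(2) by simp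
  ultimately show ?thesis using assms(3)[of "g + ?y"] by linarith
qed

section \<open>The error identity\<close>

lemma weak_grad_diff:
  assumes \<Omega>: "open \<Omega>" and u: "L2 \<Omega> u" "L2 \<Omega> g" "weak_grad \<Omega> u g"
    and v: "L2 \<Omega> v" "L2 \<Omega> h" "weak_grad \<Omega> v h"
  shows "weak_grad \<Omega> (\<lambda>x. u x - v x) (\<lambda>x. g x - h x)"
  unfolding weak_grad_def
proof (intro allI impI)
  fix \<phi> i assume \<phi>: "test_fn \<Omega> \<phi>"
  note i = L2_mult_integrable[OF _ test_fn_L2[OF \<phi> \<Omega>]] L2_mult_integrable[OF _ test_fn_L2[OF test_fn_pd[OF \<phi>] \<Omega>]]
  have "(\<integral>x. (u x - v x) * pd i \<phi> x \<partial>lebesgue_on \<Omega>) =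
      (\<integral>x. u x * pd i \<phi> x \<partial>lebesgue_on \<Omega>) - (\<integral>x. v x * pd i \<phi> x \<partial>lebesgue_on \<Omega>)"
    unfolding left_diff_distrib by (intro Bochner_Integration.integral_diff i u v)
  moreover have "(\<integral>x. (g x - h x) $ i * \<phi> x \<partial>lebesgue_on \<Omega>) =
      (\<integral>x. g x $ i * \<phi> x \<partial>lebesgue_on \<Omega>) - (\<integral>x. h x $ i * \<phi> x \<partial>lebesgue_on \<Omega>)"
    unfolding vector_minus_component left_diff_distrib
    by (intro Bochner_Integration.integral_diff i L2_nth u v)
  ultimately show "(\<integral>x. (u x - v x) * pd i \<phi> x \<partial>lebesgue_on \<Omega>)
      = - (\<integral>x. (g x - h x) $ i * \<phi> x \<partial>lebesgue_on \<Omega>)"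
    using u(3) v(3) \<phi> by (simp add: weak_grad_def)
qed

lemma weak_div_diff:
  assumes \<Omega>: "open \<Omega>" and p: "L2 \<Omega> p" "L2 \<Omega> g" "weak_div \<Omega> p g"
    and q: "L2 \<Omega> q" "L2 \<Omega> h" "weak_div \<Omega> q h"
  shows "weak_div \<Omega> (\<lambda>x. p x - q x) (\<lambda>x. g x - h x)"
  unfolding weak_div_def
proof (intro allI impI)
  fix \<phi> assume \<phi>: "test_fn \<Omega> \<phi>"
  note i = L2_mult_integrable[OF _ test_fn_L2[OF \<phi> \<Omega>]] L2_mult_integrable[OF _ test_fn_L2[OF test_fn_pd[OF \<phi>] \<Omega>]]
  have "(\<integral>x. (\<Sum>i\<in>UNIV. (p x - q x) $ i * pd i \<phi> x) \<partial>lebesgue_on \<Omega>) =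
      (\<integral>x. (\<Sum>i\<in>UNIV. p x $ i * pd i \<phi> x) \<partial>lebesgue_on \<Omega>) - (\<integral>x. (\<Sum>i\<in>UNIV. q x $ i * pd i \<phi> x) \<partial>lebesgue_on \<Omega>)"
    unfolding vector_minus_component left_diff_distrib sum_subtractf
    by (intro Bochner_Integration.integral_diff Bochner_Integration.integrable_sum i L2_nth p q)
  moreover have "(\<integral>x. (g x - h x) * \<phi> x \<partial>lebesgue_on \<Omega>) =
      (\<integral>x. g x * \<phi> x \<partial>lebesgue_on \<Omega>) - (\<integral>x. h x * \<phi> x \<partial>lebesgue_on \<Omega>)"
    unfolding left_diff_distrib by (intro Bochner_Integration.integral_diff i p q)
  ultimately show "(\<integral>x. (\<Sum>i\<in>UNIV. (p x - q x) $ i * pd i \<phi> x) \<partial>lebesgue_on \<Omega>)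
      = - (\<integral>x. (g x - h x) * \<phi> x \<partial>lebesgue_on \<Omega>)"
    using p(3) q(3) \<phi> by (simp add: weak_div_def)
qed

lemma H10_diff:
  assumes \<Omega>: "open \<Omega>" and u: "H10 \<Omega> u" "L2 \<Omega> g" "weak_grad \<Omega> u g"
    and v: "H10 \<Omega> v" "L2 \<Omega> h" "weak_grad \<Omega> v h"
  shows "H10 \<Omega> (\<lambda>x. u x - v x)"
proof -
  obtain \<phi> where \<phi>: "\<And>k. test_fn \<Omega> (\<phi> k)"
    "(\<lambda>k. l2norm \<Omega> (\<lambda>x. \<phi> k x - u x)) \<longlonglongrightarrow> 0"
    "(\<lambda>k. l2norm \<Omega> (\<lambda>x. cgrad (\<phi> k) x - g x)) \<longlonglongrightarrow> 0"
    using H10_test_fn_sequence[OF \<Omega> u] by blast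
  obtain \<psi> where \<psi>: "\<And>k. test_fn \<Omega> (\<psi> k)"
    "(\<lambda>k. l2norm \<Omega> (\<lambda>x. \<psi> k x - v x)) \<longlonglongrightarrow> 0"
    "(\<lambda>k. l2norm \<Omega> (\<lambda>x. cgrad (\<psi> k) x - h x)) \<longlonglongrightarrow> 0"
    using H10_test_fn_sequence[OF \<Omega> v] by blast
  note L2s = L2_diff[OF test_fn_L2[OF \<phi>(1) \<Omega>] H10_L2[OF u(1)]] L2_diff[OF test_fn_L2[OF \<psi>(1) \<Omega>] H10_L2[OF v(1)]]
    L2_diff[OF cgrad_L2[OF \<phi>(1) \<Omega>] u(2)] L2_diff[OF cgrad_L2[OF \<psi>(1) \<Omega>] v(2)]
  let ?\<chi> = "\<lambda>k x. \<phi> k x - \<psi> k x"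
  let ?B = "\<lambda>k. (l2norm \<Omega> (\<lambda>x. \<phi> k x - u x) + l2norm \<Omega> (\<lambda>x. \<psi> k x - v x))
      + (l2norm \<Omega> (\<lambda>x. cgrad (\<phi> k) x - g x) + l2norm \<Omega> (\<lambda>x. cgrad (\<psi> k) x - h x))"
  have "(\<lambda>k. l2norm \<Omega> (\<lambda>x. ?\<chi> k x - (u x - v x)) + l2norm \<Omega> (\<lambda>x. cgrad (?\<chi> k) x - (g x - h x))) \<longlonglongrightarrow> 0"
  proof (rule Lim_null_comparison[OF always_eventually])
    show "?B \<longlonglongrightarrow> 0"
      using tendsto_add[OF tendsto_add[OF \<phi>(2) \<psi>(2)] tendsto_add[OF \<phi>(3) \<psi>(3)]] by simp
    have eq: "?\<chi> k x - (u x - v x) = (\<phi> k x - u x) - (\<psi> k x - v x)"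
      "cgrad (?\<chi> k) x - (g x - h x) = (cgrad (\<phi> k) x - g x) - (cgrad (\<psi> k) x - h x)" for k x
      by (simp_all add: cgrad_diff[OF \<phi>(1) \<psi>(1)])
    show "\<forall>k. norm (l2norm \<Omega> (\<lambda>x. ?\<chi> k x - (u x - v x)) + l2norm \<Omega> (\<lambda>x. cgrad (?\<chi> k) x - (g x - h x))) \<le> ?B k"
      unfolding eq using l2norm_triangle_diff[OF L2s(1,2)] l2norm_triangle_diff[OF L2s(3,4)]
      by (simp add: add_mono)
  qed
  moreover have "\<And>k. test_fn \<Omega> (?\<chi> k)" by (intro test_fn_diff \<phi> \<psi>)
  moreover have "weak_grad \<Omega> (\<lambda>x. u x - v x) (\<lambda>x. g x - h x)"
    by (intro weak_grad_diff \<Omega> u v H10_L2)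
  moreover have "L2 \<Omega> (\<lambda>x. u x - v x)" "L2 \<Omega> (\<lambda>x. g x - h x)"
    by (intro L2_diff u v H10_L2)+
  ultimately show ?thesis
    unfolding H10_def
    by (intro conjI exI[of _ "\<lambda>x. g x - h x"] exI[of _ ?\<chi>]) auto
qed

lemma Linf_diff:
  fixes f g :: "real^'n::finite \<Rightarrow> 'b::euclidean_space"
  assumes "Linf \<Omega> f" "Linf \<Omega> g"
  shows "Linf \<Omega> (\<lambda>x. f x - g x)"
proof -
  obtain M N where "AE x in lebesgue_on \<Omega>. norm (f x) \<le> M" "AE x in lebesgue_on \<Omega>. norm (g x) \<le> N"
    using assms by (auto simp: Linf_def)
  then have "AE x in lebesgue_on \<Omega>. norm (f x - g x) \<le> M + N"
    by eventually_elim (rule norm_triangle_le_diff, simp)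
  then show ?thesis using assms by (auto simp: Linf_def)
qed

lemma L2_scaleR_Linf:
  fixes v :: "real^'n::finite \<Rightarrow> 'b::euclidean_space"
  assumes "Linf \<Omega> \<gamma>" "L2 \<Omega> v" shows "L2 \<Omega> (\<lambda>x. \<gamma> x *\<^sub>R v x)"
  using L2_Linf_scaleR[OF assms(1)] assms(2) by metis

lemma L2_bdot_Linf:
  fixes b :: "real^'n::finite \<Rightarrow> real^'n"
  shows "Linf \<Omega> b \<Longrightarrow> L2 \<Omega> g \<Longrightarrow> L2 \<Omega> (\<lambda>x. bdot (b x) (g x))"
  using L2_Linf_bdot[of \<Omega> b] by metis

lemma wnorm2_integrable:
  assumes "Linf \<Omega> \<gamma>" "L2 \<Omega> v"
  shows "integrable (lebesgue_on \<Omega>) (\<lambda>x. \<gamma> x * (cmod (v x))\<^sup>2)"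
  using L2_inner[OF L2_scaleR_Linf[OF assms] assms(2)] by (simp add: power2_norm_eq_inner)

text \<open>The weight 1/c removes c from the cross term, which can then cancel against terms that
  do not involve c.\<close>

lemma reaction_expand:
  fixes e r :: "'a::real_inner"
  assumes "c \<noteq> 0"
  shows "1 / c * (norm (c *\<^sub>R e + r))\<^sup>2 = c * (norm e)\<^sup>2 + 2 * (e \<bullet> r) + 1 / c * (norm r)\<^sup>2"
proof -
  have "(norm (c *\<^sub>R e + r))\<^sup>2 = c\<^sup>2 * (norm e)\<^sup>2 + 2 * c * (e \<bullet> r) + (norm r)\<^sup>2"
    unfolding power2_norm_eq_inner by (simp add: inner_simps inner_commute power2_eq_square)
  then show ?thesis using assms by (simp add: field_simps power2_eq_square)
qed

text \<open>Expand the nonnegative square of t e - r with weight 1/t, that is, the preceding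
  identity with - r in place of r.\<close>

lemma inner_Young:
  fixes e r :: "'a::real_inner"
  assumes "t > 0"
  shows "2 * (e \<bullet> r) \<le> t * (norm e)\<^sup>2 + 1 / t * (norm r)\<^sup>2"
proof -
  have "0 \<le> 1 / t * (norm (t *\<^sub>R e + (- r)))\<^sup>2" using assms by simp
  also have "\<dots> = t * (norm e)\<^sup>2 + 2 * (e \<bullet> (- r)) + 1 / t * (norm (- r))\<^sup>2"
    using assms by (intro reaction_expand) simp
  finally show ?thesis by (simp only: inner_minus_right norm_minus_cancel)
qed

lemma reaction_Young:
  fixes e r :: "'a::real_inner"
  assumes "c > 0"
  shows "1/2 * (1 / c * (norm (c *\<^sub>R e + r))\<^sup>2) \<le> c * (norm e)\<^sup>2 + 1 / c * (norm r)\<^sup>2"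
proof -
  have "1 / c * (norm (c *\<^sub>R e + r))\<^sup>2 = c * (norm e)\<^sup>2 + 2 * (e \<bullet> r) + 1 / c * (norm r)\<^sup>2"
    using assms by (intro reaction_expand) simp
  then show ?thesis using inner_Young[OF assms, of e r] by linarith
qed

theorem theorem4p1:
  fixes \<Omega> :: "(real^'n::finite) set"
    and A :: "real^'n \<Rightarrow> complex^'n^'n" and \<alpha> \<beta> :: real
    and b :: "real^'n \<Rightarrow> real^'n" and db :: "real^'n \<Rightarrow> real"
    and c :: "real^'n \<Rightarrow> real" and c\<^sub>0 C\<^sub>F :: real
    and f :: "real^'n \<Rightarrow> complex"
    and u ut :: "real^'n \<Rightarrow> complex" and gu gut :: "real^'n \<Rightarrow> complex^'n"
    and p pt :: "real^'n \<Rightarrow> complex^'n" and dp dpt :: "real^'n \<Rightarrow> complex"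
    and E2 M3plus M3minus :: real
  assumes dom: "open \<Omega>" "connected \<Omega>"
    and Friedrichs: "C\<^sub>F > 0"
      "\<And>w g. H10 \<Omega> w \<Longrightarrow> L2 \<Omega> g \<Longrightarrow> weak_grad \<Omega> w g \<Longrightarrow>
              l2norm \<Omega> w \<le> C\<^sub>F * l2norm \<Omega> g"
    and A_Linf: "Linf \<Omega> A"
    and A_herm: "\<And>x i j. x \<in> \<Omega> \<Longrightarrow> A x $ i $ j = cnj (A x $ j $ i)"
    and A_ell: "0 < \<alpha>" "\<alpha> \<le> \<beta>"
      "\<And>\<phi>. L2 \<Omega> \<phi> \<Longrightarrow> \<alpha> * (l2norm \<Omega> \<phi>)\<^sup>2 \<le> mnorm2 \<Omega> A \<phi>
                          \<and> mnorm2 \<Omega> A \<phi> \<le> \<beta> * (l2norm \<Omega> \<phi>)\<^sup>2"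
    and b_Linf: "Linf \<Omega> b" and db_Linf: "Linf \<Omega> db"
    and b_div: "weak_div \<Omega> (\<lambda>x. cvec (b x)) (\<lambda>x. complex_of_real (db x))"
    and f_L2: "L2 \<Omega> f"
    and c_Linf: "Linf \<Omega> c"
    and c_nonneg: "AE x in lebesgue_on \<Omega>. c x \<ge> 0"
    and c0: "c\<^sub>0 > 0" "AE x in lebesgue_on \<Omega>. c x \<noteq> 0 \<longrightarrow> c x \<ge> c\<^sub>0"
    and c_divb: "AE x in lebesgue_on \<Omega>. c x - db x \<ge> 0"
    and u: "H10 \<Omega> u" "L2 \<Omega> gu" "weak_grad \<Omega> u gu"
    and p: "Hdiv \<Omega> p" "L2 \<Omega> dp" "weak_div \<Omega> p dp"
    and P1: "AE x in lebesgue_on \<Omega>. p x = A x *v gu x"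
      "AE x in lebesgue_on \<Omega>. - dp x + bdot (b x) (gu x) + complex_of_real (c x) * u x = f x"
    and ut: "H10 \<Omega> ut" "L2 \<Omega> gut" "weak_grad \<Omega> ut gut"
    and pt: "Hdiv \<Omega> pt" "L2 \<Omega> dpt" "weak_div \<Omega> pt dpt"
    and E2_def: "E2 = wnorm2 \<Omega> (\<lambda>x. c x - db x) (\<lambda>x. u x - ut x)
        + mnorm2 \<Omega> A (\<lambda>x. gu x - gut x)
        + mnorm2 \<Omega> (\<lambda>x. matrix_inv (A x)) (\<lambda>x. p x - pt x)
        + wnorm2 \<Omega> (\<lambda>x. 1 / (c x + (if c x = 0 then 1 else 0)))
            (\<lambda>x. bdot (b x) (gu x - gut x) - (dp x - dpt x))"
    and M3plus_def: "M3plus =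
        2 * (wnorm2 \<Omega> (\<lambda>x. if c x \<noteq> 0 then 1 / c x else 0)
               (\<lambda>x. f x - complex_of_real (c x) * ut x - bdot (b x) (gut x) + dpt x)
             + mnorm2 \<Omega> (\<lambda>x. matrix_inv (A x)) (\<lambda>x. pt x - A x *v gut x))
        + (1 + 4 * C\<^sub>F\<^sup>2 / \<alpha>) * wnorm2 \<Omega> (\<lambda>x. if c x = 0 then 1 else 0)
               (\<lambda>x. f x - bdot (b x) (gut x) + dpt x)"
    and M3minus_def: "M3minus =
        1/2 * (wnorm2 \<Omega> (\<lambda>x. if c x \<noteq> 0 then 1 / c x else 0)
               (\<lambda>x. f x - complex_of_real (c x) * ut x - bdot (b x) (gut x) + dpt x)
             + mnorm2 \<Omega> (\<lambda>x. matrix_inv (A x)) (\<lambda>x. pt x - A x *v gut x))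
        + wnorm2 \<Omega> (\<lambda>x. if c x = 0 then 1 else 0)
               (\<lambda>x. f x - bdot (b x) (gut x) + dpt x)"
  shows "wnorm2 \<Omega> (\<lambda>x. if c x = 0 then 1 else 0) (\<lambda>x. f x - bdot (b x) (gut x) + dpt x)
           + 1/2 * mnorm2 \<Omega> (\<lambda>x. matrix_inv (A x)) (\<lambda>x. pt x - A x *v gut x) \<le> E2
         \<and> E2 \<le> M3plus
         \<and> ((AE x in lebesgue_on \<Omega>. c x \<noteq> 0 \<longrightarrow> - db x \<ge> 0) \<longrightarrow> M3minus \<le> E2)"
proof -

  \<comment> \<open>Error functions, weights and integrability\<close>
  let ?M = "lebesgue_on \<Omega>"
  define e g q d where "e = (\<lambda>x. u x - ut x)" and "g = (\<lambda>x. gu x - gut x)"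
    and "q = (\<lambda>x. p x - pt x)" and "d = (\<lambda>x. dp x - dpt x)"
  define r where "r = (\<lambda>x. bdot (b x) (g x) - d x)"
  have p_L2: "L2 \<Omega> p" "L2 \<Omega> pt" using p pt by (auto simp: Hdiv_def)
  note u_L2 = H10_L2[OF u(1)] and ut_L2 = H10_L2[OF ut(1)]
  have L2: "L2 \<Omega> e" "L2 \<Omega> g" "L2 \<Omega> q" "L2 \<Omega> d"
    unfolding e_def g_def q_def d_def
    by (intro L2_diff u_L2 ut_L2 u(2) ut(2) p_L2 p(2) pt(2))+
  have bg_L2: "L2 \<Omega> (\<lambda>x. bdot (b x) (g x))" by (intro L2_bdot_Linf b_Linf L2)
  then have r_L2: "L2 \<Omega> r" unfolding r_def by (intro L2_diff L2)
  have e_H10: "H10 \<Omega> e" and eg: "weak_grad \<Omega> e g"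
    unfolding e_def g_def
    by (rule H10_diff[OF dom(1) u ut]) (rule weak_grad_diff[OF dom(1) u_L2 u(2,3) ut_L2 ut(2,3)])
  have qd: "weak_div \<Omega> q d"
    unfolding q_def d_def by (rule weak_div_diff[OF dom(1) p_L2(1) p(2,3) p_L2(2) pt(2,3)])
  have [measurable]: "c \<in> borel_measurable ?M" "A \<in> borel_measurable ?M"
    using c_Linf A_Linf by (auto simp: Linf_def)
  have ell: "AE x in ?M. \<forall>v. \<alpha> * (norm v)\<^sup>2 \<le> (A x *v v) \<bullet> v"
    by (rule elliptic_AE[OF dom(1) A_Linf A_ell(3)[THEN conjunct1]])
  have herm: "AE x in ?M. \<forall>i j. A x $ i $ j = cnj (A x $ j $ i)"
  proof (rule AE_I2)
    fix x assume "x \<in> space ?M"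
    then have "x \<in> \<Omega>" by simp
    then show "\<forall>i j. A x $ i $ j = cnj (A x $ j $ i)" by (intro allI A_herm)
  qed
  \<comment> \<open>The weights of E^2, of the reaction residual and of the residual on c = 0;
    pointwise \<gamma> = \<eta> + \<xi>. They are essentially bounded because c is at least
    \<open>c\<^sub>0\<close> wherever it is nonzero.\<close>
  define \<gamma> \<eta> \<xi> where "\<gamma> = (\<lambda>x. 1 / (c x + (if c x = 0 then 1 else 0)))"
    and "\<eta> = (\<lambda>x. if c x \<noteq> 0 then 1 / c x else 0)" and "\<xi> = (\<lambda>x. if c x = 0 then 1 else 0 :: real)"
  have w_Linf: "Linf \<Omega> \<gamma>" "Linf \<Omega> \<eta>" "Linf \<Omega> \<xi>"
  proof -
    have inv: "\<bar>1 / c x\<bar> \<le> 1 / c\<^sub>0" if "c\<^sub>0 \<le> c x" for x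
    proof -
      have "0 < c x" using that c0(1) by linarith
      then show ?thesis using divide_left_mono[OF that, of 1] c0(1) by simp
    qed
    have "AE x in ?M. norm (\<gamma> x) \<le> max (1 / c\<^sub>0) 1 \<and> norm (\<eta> x) \<le> 1 / c\<^sub>0"
      using c0(2)
    proof eventually_elim
      case (elim x)
      then show ?case using inv[of x] c0(1) by (cases "c x = 0") (auto simp: \<gamma>_def \<eta>_def)
    qed
    then have "AE x in ?M. norm (\<gamma> x) \<le> max (1 / c\<^sub>0) 1" "AE x in ?M. norm (\<eta> x) \<le> 1 / c\<^sub>0"
      by auto
    moreover have "AE x in ?M. norm (\<xi> x) \<le> 1" by (auto simp: \<xi>_def)
    moreover have "\<gamma> \<in> borel_measurable ?M" "\<eta> \<in> borel_measurable ?M" "\<xi> \<in> borel_measurable ?M"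
      unfolding \<gamma>_def \<eta>_def \<xi>_def by measurable
    ultimately show "Linf \<Omega> \<gamma>" "Linf \<Omega> \<eta>" "Linf \<Omega> \<xi>" unfolding Linf_def by blast+
  qed
  note inv_L2 = L2_matrix_inv[OF A_ell(1) \<open>A \<in> borel_measurable ?M\<close> _ ell]
  have Ag_L2: "L2 \<Omega> (\<lambda>x. A x *v g x)" by (intro L2_matrix_vector_mult A_Linf L2)
  have cr_L2: "L2 \<Omega> (\<lambda>x. c x *\<^sub>R e x + r x)" by (intro L2_add L2_scaleR_Linf c_Linf L2 r_L2)

  \<comment> \<open>Densities: \<open>a1\<close> to \<open>a4\<close> integrate to the four terms of
    E^2, \<open>s1\<close> to \<open>s3\<close> to the residual norms of the majorant.\<close>
  define a1 where "a1 x = (c x - db x) * (norm (e x))\<^sup>2" for x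
  define a2 where "a2 x = (A x *v g x) \<bullet> g x" for x
  define a3 where "a3 x = (matrix_inv (A x) *v q x) \<bullet> q x" for x
  define a4 where "a4 x = \<gamma> x * (norm (r x))\<^sup>2" for x
  define s1 where "s1 x = \<eta> x * (norm (c x *\<^sub>R e x + r x))\<^sup>2" for x
  define s2 where "s2 x = (matrix_inv (A x) *v (A x *v g x - q x)) \<bullet> (A x *v g x - q x)" for x
  define s3 where "s3 x = \<xi> x * (norm (r x))\<^sup>2" for x
  \<comment> \<open>The combination of cross terms whose integral vanishes: the first two summands
    by the convection identity, the last two by Green's formula.\<close>
  define z where "z x = - ((db x *\<^sub>R e x) \<bullet> e x) - 2 * (bdot (b x) (g x) \<bullet> e x)
    + 2 * (e x \<bullet> d x) + 2 * (g x \<bullet> q x)" for x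
  \<comment> \<open>The cross term left over on c = 0, where \<open>s1\<close> vanishes and supplies
    no e \<bullet> r.\<close>
  define w where "w x = 2 * ((\<xi> x *\<^sub>R e x) \<bullet> r x)" for x
  have int: "integrable ?M a1" "integrable ?M a2" "integrable ?M a3" "integrable ?M a4"
    "integrable ?M s1" "integrable ?M s2" "integrable ?M s3" "integrable ?M w"
    unfolding a1_def a2_def a3_def a4_def s1_def s2_def s3_def w_def
    by (intro wnorm2_integrable L2_inner Linf_diff c_Linf db_Linf w_Linf L2 r_L2 cr_L2 inv_L2 Ag_L2 L2_diff
        L2_scaleR_Linf integrable_mult_right)+
  note zi = L2_inner[OF L2_scaleR_Linf[OF db_Linf L2(1)] L2(1)] L2_inner[OF bg_L2 L2(1)]
    L2_inner[OF L2(1,4)] L2_inner[OF L2(2,3)]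
  have z_int: "integrable ?M z" unfolding z_def using zi by auto
  have z_0: "(\<integral>x. z x \<partial>?M) = 0"
  proof -
    have "(\<integral>x. z x \<partial>?M) = - (\<integral>x. (db x *\<^sub>R e x) \<bullet> e x \<partial>?M) - 2 * (\<integral>x. bdot (b x) (g x) \<bullet> e x \<partial>?M)
        + 2 * (\<integral>x. e x \<bullet> d x \<partial>?M) + 2 * (\<integral>x. g x \<bullet> q x \<partial>?M)"
      unfolding z_def using zi by simp
    then show ?thesis
      using H10_Green[OF dom(1) e_H10 L2(2) eg L2(3,4) qd]
        H10_convection[OF dom(1) e_H10 L2(2) eg b_Linf db_Linf b_div] by simp
  qed

  \<comment> \<open>Residuals in terms of the error\<close>
  have E2: "E2 = (\<integral>x. a1 x \<partial>?M) + (\<integral>x. a2 x \<partial>?M) + (\<integral>x. a3 x \<partial>?M) + (\<integral>x. a4 x \<partial>?M)"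
    unfolding E2_def wnorm2_def mnorm2_def Re_cdot a1_def a2_def a3_def a4_def e_def g_def q_def r_def d_def \<gamma>_def
    by simp
  have res: "AE x in ?M. f x - complex_of_real (c x) * ut x - bdot (b x) (gut x) + dpt x = c x *\<^sub>R e x + r x"
    using P1(2)
  proof eventually_elim
    case (elim x)
    show ?case
      unfolding elim[symmetric] e_def r_def g_def d_def
      by (simp add: bdot_diff scaleR_conv_of_real algebra_simps)
  qed
  have fm: "L2 \<Omega> (\<lambda>x. f x - bdot (b x) (gut x) + dpt x)"
    by (intro L2_add L2_diff f_L2 L2_bdot_Linf b_Linf ut pt)
  have "L2 \<Omega> (\<lambda>x. (f x - bdot (b x) (gut x) + dpt x) - c x *\<^sub>R ut x)"
    by (intro L2_diff fm L2_scaleR_Linf c_Linf ut_L2)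
  then have fcm: "L2 \<Omega> (\<lambda>x. f x - complex_of_real (c x) * ut x - bdot (b x) (gut x) + dpt x)"
    by (simp add: scaleR_conv_of_real algebra_simps)
  have S1: "wnorm2 \<Omega> \<eta> (\<lambda>x. f x - complex_of_real (c x) * ut x - bdot (b x) (gut x) + dpt x) = (\<integral>x. s1 x \<partial>?M)"
    unfolding wnorm2_def
  proof (rule integral_cong_AE)
    show "AE x in ?M. \<eta> x * (cmod (f x - complex_of_real (c x) * ut x - bdot (b x) (gut x) + dpt x))\<^sup>2 = s1 x"
      using res by eventually_elim (simp add: s1_def)
  qed (use wnorm2_integrable[OF w_Linf(2) fcm] int in auto)
  have S3: "wnorm2 \<Omega> \<xi> (\<lambda>x. f x - bdot (b x) (gut x) + dpt x) = (\<integral>x. s3 x \<partial>?M)"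
    unfolding wnorm2_def
  proof (rule integral_cong_AE)
    \<comment> \<open>Where \<xi> is nonzero, c vanishes, so the residuals with and without the
      reaction term coincide and \<open>res\<close> applies.\<close>
    show "AE x in ?M. \<xi> x * (cmod (f x - bdot (b x) (gut x) + dpt x))\<^sup>2 = s3 x"
      using res by eventually_elim (auto simp: s3_def \<xi>_def)
  qed (use wnorm2_integrable[OF w_Linf(3) fm] int in auto)
  have ps_L2: "L2 \<Omega> (\<lambda>x. pt x - A x *v gut x)"
    by (intro L2_diff p_L2 L2_matrix_vector_mult A_Linf ut)
  have S2: "mnorm2 \<Omega> (\<lambda>x. matrix_inv (A x)) (\<lambda>x. pt x - A x *v gut x) = (\<integral>x. s2 x \<partial>?M)"
    unfolding mnorm2_def Re_cdot
  proof (rule integral_cong_AE)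
    show "AE x in ?M. (matrix_inv (A x) *v (pt x - A x *v gut x)) \<bullet> (pt x - A x *v gut x) = s2 x"
      using P1(1)
    proof eventually_elim
      case (elim x)
      have "pt x - A x *v gut x = A x *v g x - q x"
        unfolding q_def g_def elim by (simp add: matrix_vector_mult_diff_distrib)
      then show ?case by (simp add: s2_def)
    qed
  qed (use L2_inner[OF inv_L2[OF ps_L2] ps_L2] int in auto)

  \<comment> \<open>The first conjunct is the density form of the error identity, the others are the
    pointwise bounds. The last two are separate because a sign of - div b is an assumption only
    where c \<noteq> 0; where c = 0 it is contained in c - div b \<ge> 0.\<close>
  have good: "AE x in ?M. a1 x + a2 x + a3 x + a4 x = s1 x + s2 x + s3 x + z x + w x
      \<and> s3 x + a2 x \<le> a1 x + a2 x + a3 x + a4 x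
      \<and> s3 x + 1/2 * s2 x \<le> a1 x + a2 x + a3 x + a4 x
      \<and> \<alpha> * (norm (g x))\<^sup>2 \<le> a2 x
      \<and> (c x \<noteq> 0 \<longrightarrow> - db x \<ge> 0 \<longrightarrow> 1/2 * (s1 x + s2 x) + s3 x \<le> a1 x + a2 x + a3 x + a4 x)
      \<and> (c x = 0 \<longrightarrow> 1/2 * (s1 x + s2 x) + s3 x \<le> a1 x + a2 x + a3 x + a4 x)"
    using ell herm c_nonneg c_divb
  proof eventually_elim
    case (elim x)
    have A: "\<And>v. \<alpha> * (norm v)\<^sup>2 \<le> (A x *v v) \<bullet> v" "\<And>i j. A x $ i $ j = cnj (A x $ j $ i)"
      using elim by blast+
    have s2: "s2 x = a2 x + a3 x - 2 * (g x \<bullet> q x)"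
      unfolding s2_def a2_def a3_def by (rule elliptic_dual_expand[OF A(2) A_ell(1) A(1)])
    have Y: "0 \<le> a2 x + a3 x + 2 * (g x \<bullet> q x)"
      unfolding a2_def a3_def by (rule elliptic_dual_Young[OF A(2) A_ell(1) A(1)])
    have a3: "0 \<le> a3 x"
    proof -
      let ?y = "matrix_inv (A x) *v q x"
      have "a3 x = (A x *v ?y) \<bullet> ?y"
        by (simp add: a3_def elliptic_matrix_inv[OF A_ell(1) A(1)] inner_commute)
      moreover have "0 \<le> \<alpha> * (norm ?y)\<^sup>2" using A_ell(1) by simp
      ultimately show ?thesis using A(1)[of ?y] by linarith
    qed
    have a1: "0 \<le> a1 x" using elim(4) by (simp add: a1_def)
    have sq: "(norm v)\<^sup>2 = v \<bullet> v" for v :: complex by (rule power2_norm_eq_inner)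
    \<comment> \<open>As r = b . g - d, the convection and divergence terms merge into a single
      multiple of e \<bullet> r, matching the cross term of the reaction residual.\<close>
    have zz: "z x = - db x * (norm (e x))\<^sup>2 - 2 * (e x \<bullet> r x) + 2 * (g x \<bullet> q x)"
      unfolding z_def r_def sq by (simp add: inner_simps inner_commute)
    show ?case
    proof (cases "c x = 0")
      case True
      then have "\<gamma> x = 1" "\<eta> x = 0" "\<xi> x = 1" by (auto simp: \<gamma>_def \<eta>_def \<xi>_def)
      then have "s1 x = 0" "s3 x = a4 x" "w x = 2 * (e x \<bullet> r x)" "a1 x = - db x * (norm (e x))\<^sup>2"
        using True by (auto simp: s1_def s3_def a4_def w_def a1_def)
      then show ?thesis
        using s2 Y a3 a1 zz True A(1)[of "g x"] by (auto simp: a2_def)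
    next
      case False
      then have c: "c x > 0" and "\<gamma> x = 1 / c x" "\<eta> x = 1 / c x" "\<xi> x = 0"
        using elim(3) by (auto simp: \<gamma>_def \<eta>_def \<xi>_def)
      then have s: "s1 x = 1 / c x * (norm (c x *\<^sub>R e x + r x))\<^sup>2" "s3 x = 0"
          "a4 x = 1 / c x * (norm (r x))\<^sup>2" "w x = 0" "0 \<le> a4 x"
        by (auto simp: s1_def s3_def a4_def w_def)
      have s1: "s1 x = c x * (norm (e x))\<^sup>2 + 2 * (e x \<bullet> r x) + a4 x"
        unfolding s(1,3) by (rule reaction_expand[OF False])
      have s1_le: "1/2 * s1 x \<le> c x * (norm (e x))\<^sup>2 + a4 x"
        unfolding s(1,3) by (rule reaction_Young[OF c])
      have a1_eq: "a1 x = c x * (norm (e x))\<^sup>2 + - db x * (norm (e x))\<^sup>2"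
        by (simp add: a1_def algebra_simps)
      have le: "1/2 * (s1 x + s2 x) + s3 x \<le> a1 x + a2 x + a3 x + a4 x" if "- db x \<ge> 0"
      proof -
        have "c x * (norm (e x))\<^sup>2 \<le> a1 x"
          unfolding a1_eq using mult_nonneg_nonneg[OF that zero_le_power2[of "norm (e x)"]] by linarith
        moreover have "1/2 * s2 x \<le> a2 x + a3 x" using s2 Y by linarith
        moreover have "1/2 * (s1 x + s2 x) = 1/2 * s1 x + 1/2 * s2 x" by (rule distrib_left)
        ultimately show ?thesis using s(2) s1_le by linarith
      qed
      have a2: "\<alpha> * (norm (g x))\<^sup>2 \<le> a2 x" unfolding a2_def by (rule A(1))
      show ?thesis
        using s(2,4,5) s1 s2 Y a3 a1 a1_eq zz False le a2
        by (intro conjI impI) (linarith | blast)+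
    qed
  qed

  \<comment> \<open>Integration of the pointwise bounds\<close>
  let ?E = "\<lambda>x. a1 x + a2 x + a3 x + a4 x"
  have E_int: "integrable ?M ?E" and E_eq: "E2 = (\<integral>x. ?E x \<partial>?M)"
    using int by (simp_all add: E2)
  let ?S1 = "\<integral>x. s1 x \<partial>?M" and ?S2 = "\<integral>x. s2 x \<partial>?M" and ?S3 = "\<integral>x. s3 x \<partial>?M"
    and ?A2 = "\<integral>x. a2 x \<partial>?M" and ?W = "\<integral>x. w x \<partial>?M"

  have lower: "?S3 + 1/2 * ?S2 \<le> E2"
  proof -
    have "(\<integral>x. s3 x + 1/2 * s2 x \<partial>?M) \<le> E2"
      unfolding E_eq by (intro integral_mono_AE E_int) (use good int in \<open>auto elim: eventually_mono\<close>)
    then show ?thesis using int by simp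
  qed

  \<comment> \<open>Keeping \<open>?S3\<close> beside \<open>?A2\<close> lets half of E2 -
    \<open>?S3\<close> be absorbed instead of half of E2. After doubling, this leaves the
    coefficient 1, rather than 2, in 1 + 4 C_F^2/\<alpha>.\<close>
  have "?S3 + ?A2 \<le> E2"
  proof -
    have "(\<integral>x. s3 x + a2 x \<partial>?M) \<le> E2"
      unfolding E_eq by (intro integral_mono_AE E_int) (use good int in \<open>auto elim: eventually_mono\<close>)
    then show ?thesis using int by simp
  qed
  moreover have "E2 = ?S1 + ?S2 + ?S3 + ?W"
  proof -
    have "E2 = (\<integral>x. s1 x + s2 x + s3 x + z x + w x \<partial>?M)"
      unfolding E_eq by (intro integral_cong_AE) (use good int z_int in \<open>auto elim: eventually_mono\<close>)
    then show ?thesis using int z_int z_0 by simp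
  qed
  moreover have "?W \<le> 1/2 * ?A2 + 2 * C\<^sub>F\<^sup>2 / \<alpha> * ?S3"
  proof -
    \<comment> \<open>Friedrichs' inequality and ellipticity bound t ||e||^2 by t C_F^2/\<alpha>
      times \<open>?A2\<close>; this t makes the factor exactly 1/2. The price 1/t = 2
      C_F^2/\<alpha> on \<open>?S3\<close> doubles to 4 C_F^2/\<alpha> in the majorant.\<close>
    define t where "t = \<alpha> / (2 * C\<^sub>F\<^sup>2)"
    have t: "t > 0" "1 / t = 2 * C\<^sub>F\<^sup>2 / \<alpha>" "t * C\<^sub>F\<^sup>2 = \<alpha> / 2"
      using A_ell(1) Friedrichs(1) by (auto simp: t_def)
    note ei = L2_integrable[OF L2(1)] and gi = L2_integrable[OF L2(2)]
    have "w x \<le> t * (norm (e x))\<^sup>2 + 1 / t * s3 x" for x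
      using inner_Young[OF t(1), of "e x" "r x"] t(1) by (auto simp: w_def s3_def \<xi>_def)
    then have "?W \<le> (\<integral>x. t * (norm (e x))\<^sup>2 + 1 / t * s3 x \<partial>?M)"
      using int ei by (intro integral_mono) auto
    also have "\<dots> = t * (l2norm \<Omega> e)\<^sup>2 + 1 / t * ?S3"
      using int ei by (simp add: l2norm_squared)
    also have "t * (l2norm \<Omega> e)\<^sup>2 \<le> t * (C\<^sub>F * l2norm \<Omega> g)\<^sup>2"
      using Friedrichs(2)[OF e_H10 L2(2) eg] t(1) by (intro mult_left_mono power_mono) auto
    also have "\<dots> = 1/2 * (\<alpha> * (l2norm \<Omega> g)\<^sup>2)"
      using t(3) by (simp add: power_mult_distrib mult.assoc[symmetric])
    also have "\<alpha> * (l2norm \<Omega> g)\<^sup>2 = (\<integral>x. \<alpha> * (norm (g x))\<^sup>2 \<partial>?M)"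
      by (simp add: l2norm_squared)
    also have "\<dots> \<le> ?A2"
      by (intro integral_mono_AE) (use good int gi in \<open>auto elim: eventually_mono\<close>)
    finally show ?thesis unfolding t(2) by simp
  qed
  ultimately have upper: "E2 \<le> 2 * (?S1 + ?S2) + (1 + 4 * C\<^sub>F\<^sup>2 / \<alpha>) * ?S3"
    by (simp add: algebra_simps)

  have lower': "1/2 * (?S1 + ?S2) + ?S3 \<le> E2" if "AE x in ?M. c x \<noteq> 0 \<longrightarrow> - db x \<ge> 0"
  proof -
    have "AE x in ?M. 1/2 * (s1 x + s2 x) + s3 x \<le> ?E x"
      using good that by eventually_elim auto
    then have "(\<integral>x. 1/2 * (s1 x + s2 x) + s3 x \<partial>?M) \<le> E2"
      unfolding E_eq by (intro integral_mono_AE E_int) (use int in auto)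
    then show ?thesis using int by simp
  qed
  have M3: "M3plus = 2 * (?S1 + ?S2) + (1 + 4 * C\<^sub>F\<^sup>2 / \<alpha>) * ?S3"
    "M3minus = 1/2 * (?S1 + ?S2) + ?S3"
    unfolding M3plus_def M3minus_def by (simp_all only: S1[unfolded \<eta>_def] S2 S3[unfolded \<xi>_def])
  show ?thesis
    using lower upper lower' unfolding M3 S2 S3[unfolded \<xi>_def] by blast
qed

end
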